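(* Let $r\geq 2$ be an integer, let $c=r^{-(2r+9)(r+1)}/2$, let $0<b<2^{-10}r^{-6}$, let $n\geq e^{2/c}$, and let $G$ be a graph of order $n$. If $\mu(G)>(1-1/r-b)n$, then at least one of the following holds: (a) $G$ contains a subgraph isomorphic to $K_r^{+}(\lfloor c\ln n\rfloor,\ldots,\lfloor c\ln n\rfloor)$ (all $r$ parts of size $\lfloor c\ln n\rfloor$); (b) $G$ contains an induced subgraph $G_0$ which is $r$-partite, has at least $(1-4b^{1/3})n$ vertices, and has minimum degree $\delta(G_0)>(1-1/r-7b^{1/3})n$.
   Context: All graphs are finite and simple; $\ln$ is the natural logarithm. For a graph $G$, $\mu(G)$ denotes the largest eigenvalue of the adjacency matrix of $G$, and $\delta(G)$ its minimum degree. A graph is $r$-partite if its vertex set can be partitioned into $r$ independent sets. For integers $s_1\geq 2, s_2,\ldots,s_r\ge 1$, $K_r^{+}(s_1,\ldots,s_r)$ denotes the complete $r$-partite graph with parts of sizes $s_1,\ldots,s_r$ together with one additional edge joining two vertices of the first part. *)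

theory Defs
  imports
    "HOL-Library.Disjoint_Sets"
    "Graph_Theory.Digraph_Isomorphism"
    "Jordan_Normal_Form.Spectral_Radius"
begin

text \<open>
  A finite simple graph is a \<^locale>\<open>pair_graph\<close>: a finite, loop-free, symmetric digraph without
  parallel arcs. An undirected edge joining \<open>u\<close> and \<open>v\<close> is the pair of arcs \<open>(u, v)\<close>, \<open>(v, u)\<close>.
\<close>

text \<open>
  Matrices are indexed by natural numbers, so an adjacency matrix depends on a numbering of the
  vertices. Different numberings give permutation-similar matrices, with the same eigenvalues.
\<close>

definition vertex_numbering :: "'a pair_pre_digraph \<Rightarrow> nat \<Rightarrow> 'a" where
  "vertex_numbering G = (SOME f. bij_betw f {0..<card (pverts G)} (pverts G))"

definition adjacency_matrix :: "'a pair_pre_digraph \<Rightarrow> real mat" where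
  "adjacency_matrix G = mat (card (pverts G)) (card (pverts G))
     (\<lambda>(i, j). if (vertex_numbering G i, vertex_numbering G j) \<in> parcs G then 1 else 0)"

definition largest_eigenvalue :: "'a pair_pre_digraph \<Rightarrow> real" where
  "largest_eigenvalue G = Max (spectrum (adjacency_matrix G))"

text \<open>The arcs leaving \<open>v\<close> correspond to the edges at \<open>v\<close>, so the degree of \<open>v\<close> is its out-degree.\<close>

definition min_degree :: "'a pair_pre_digraph \<Rightarrow> nat" where
  "min_degree G = Min (out_degree (with_proj G) ` pverts G)"

definition independent_set :: "'a pair_pre_digraph \<Rightarrow> 'a set \<Rightarrow> bool" where
  "independent_set G S \<longleftrightarrow> S \<subseteq> pverts G \<and> (\<forall>u\<in>S. \<forall>v\<in>S. (u, v) \<notin> parcs G)"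

text \<open>As usual for \<open>r\<close>-partite graphs, some of the \<open>r\<close> classes may be empty.\<close>

definition partite :: "nat \<Rightarrow> 'a pair_pre_digraph \<Rightarrow> bool" where
  "partite r G \<longleftrightarrow> (\<exists>V :: nat \<Rightarrow> 'a set. disjoint_family_on V {..<r} \<and>
     (\<Union>i<r. V i) = pverts G \<and> (\<forall>i<r. independent_set G (V i)))"

text \<open>
  The graph $K_r^+(s_1,\ldots,s_r)$. Parts are numbered from 0, the vertex \<open>(i, j)\<close> is the \<open>j\<close>-th
  vertex of part \<open>i\<close>, and the additional edge joins \<open>(0, 0)\<close> and \<open>(0, 1)\<close>. Intended for
  \<open>r \<ge> 1\<close> and \<open>s 0 \<ge> 2\<close>.
\<close>

definition K_plus :: "nat \<Rightarrow> (nat \<Rightarrow> nat) \<Rightarrow> (nat \<times> nat) pair_pre_digraph" where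
  "K_plus r s = \<lparr>
     pverts = (SIGMA i:{..<r}. {..<s i}),
     parcs = {(u, v). u \<in> (SIGMA i:{..<r}. {..<s i}) \<and> v \<in> (SIGMA i:{..<r}. {..<s i}) \<and> fst u \<noteq> fst v}
       \<union> {((0, 0), (0, 1)), ((0, 1), (0, 0))} \<rparr>"

lemma pair_graph_K_plus:
  assumes "1 \<le> r" and "2 \<le> s 0"
  shows "pair_graph (K_plus r s)"
proof -
  let ?V = "SIGMA i:{..<r}. {..<s i}"
  have sub: "parcs (K_plus r s) \<subseteq> ?V \<times> ?V"
    using assms by (auto simp: K_plus_def)
  have fin: "finite ?V" by simp
  show ?thesis
  proof unfold_locales
    show "finite (parcs (K_plus r s))"
      using sub fin by (meson finite_SigmaI finite_subset)
    show "finite (pverts (K_plus r s))"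
      by (simp add: K_plus_def)
    show "symmetric (with_proj (K_plus r s))"
      by (auto simp: symmetric_def K_plus_def sym_def)
  next
    fix e assume "e \<in> parcs (K_plus r s)"
    then show "fst e \<in> pverts (K_plus r s)" "snd e \<in> pverts (K_plus r s)" "fst e \<noteq> snd e"
      using assms by (auto simp: K_plus_def)
  qed
qed

end

theory Submission
  imports Defs "HOL-Analysis.Function_Topology" "HOL-Analysis.Convex"
begin

text \<open>
  As long as some vertex has degree at most \<open>\<mu> - \<alpha> m\<close>, where \<open>m\<close> is the current order and
  \<open>\<alpha> = 1/(8 r\<^sup>4)\<close>, delete the vertex with the smallest entry in the Perron vector; then \<open>\<mu>/m\<close>
  grows by a factor of at least \<open>1 + \<alpha>/(m - 1)\<close>. Since \<open>\<mu> \<le> m\<close>, the process stops at an induced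
  subgraph on a set \<open>S\<close> that still contains a positive proportion of the vertices and has minimum
  degree about \<open>(1 - 1/r) m\<close>.

  If \<open>S\<close> contains an \<open>(r+1)\<close>-clique, convexity yields an edge of the clique whose codegree is so large
  that greedily chosen \<open>(r-1)\<close>-cliques in the common neighbourhood have positive density. Extending
  them by one vertex and blowing up the resulting dense family of \<open>r\<close>-cliques gives \<open>K\<^sub>r\<^sup>+\<close>.

  Otherwise the large minimum degree makes \<open>S\<close> an \<open>r\<close>-partite set. Then \<open>\<mu> \<le> (1 - 1/r) m\<close>, so only
  few vertices were deleted, and the defect in this inequality controls the sizes of the classes and
  the weight of the missing edges between them. Deleting the few vertices with many missing edges gives
  \<open>G\<^sub>0\<close>.
\<close>

text \<open>The spectral hypothesis controls only averages, while both alternatives rest on a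
  minimum-degree bound; hence the deletions. The deleted vertex is chosen by its Perron entry
  because that entry alone determines how the form and the norm change. The potential is used twice:
  with l \<le> m it bounds ln(n/m) by 3/\<alpha>, which suffices for a blow-up of logarithmic size;
  with l \<le> (1 - 1/r) m it bounds ln(n/m) by a multiple of b r^4, which is below b^(1/3).

  The constant \<alpha> is dictated by \<eta> = 1/(7 r^4), the excess of the non-neighbourhoods over
  m/r that the codegree estimate tolerates: \<alpha> + b must not exceed \<eta>. The size of 1/c has
  to dominate both 24 r^4, the logarithm of the possible loss of vertices, and r^((2r+3)(r-1)),
  which bounds the exponent in the blow-up. The cube root arises because a total missing weight b is
  shared by vertices that each miss weight at least \<beta>: these have weight at most b/\<beta>,
  which is \<beta>^2 exactly for \<beta> = b^(1/3).\<close>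

lemma sum_power2_le_card:
  fixes x :: "'b \<Rightarrow> real"
  shows "(\<Sum>u\<in>A. x u)\<^sup>2 \<le> card A * (\<Sum>u\<in>A. (x u)\<^sup>2)"
  using Cauchy_Schwarz_ineq_sum [of "\<lambda>_. 1" x A] by simp

lemma sum_card_swap:
  assumes "finite A" "finite B"
  shows "(\<Sum>x\<in>A. card {y \<in> B. R x y}) = (\<Sum>y\<in>B. card {x \<in> A. R x y})"
  using sum.swap_restrict [OF assms, of "\<lambda>_ _. 1::nat" R] by simp

lemma abs_le_of_square: "a\<^sup>2 \<le> c\<^sup>2 \<Longrightarrow> 0 \<le> c \<Longrightarrow> \<bar>a\<bar> \<le> (c::real)"
  by (simp add: abs_le_square_iff [symmetric])

text \<open>A bare relation keeps the graph fixed while the vertex set shrinks: neighbourhoods,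
  cliques and forms take the set as an argument, and no induced digraph is formed before the very
  end.\<close>

locale simple_graph_relation =
  fixes E :: "'a \<Rightarrow> 'a \<Rightarrow> bool"
  assumes E_sym: "E u v \<Longrightarrow> E v u"
    and E_irrefl: "\<not> E u u"
begin

definition nb :: "'a set \<Rightarrow> 'a \<Rightarrow> 'a set" where
  "nb S u = {v \<in> S. E u v}"

text \<open>Since there are no loops, a vertex of S belongs to its own set; in a complete r-partite
  graph this set is its class.\<close>

definition nnb :: "'a set \<Rightarrow> 'a \<Rightarrow> 'a set" where
  "nnb S u = {v \<in> S. \<not> E u v}"

text \<open>Ordered lists, so each clique occurs once per ordering: positions later become the parts
  of the blow-up, and counting proceeds by consing a vertex onto a list. By symmetry
  \<open>sorted_wrt\<close> already makes any two positions adjacent.\<close>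

definition cliques :: "nat \<Rightarrow> 'a set \<Rightarrow> 'a list set" where
  "cliques k S = {xs. length xs = k \<and> set xs \<subseteq> S \<and> sorted_wrt E xs}"

text \<open>The quadratic form of the adjacency matrix of the graph induced on S, each edge
  contributing twice.\<close>

definition qform :: "'a set \<Rightarrow> ('a \<Rightarrow> real) \<Rightarrow> real" where
  "qform S x = (\<Sum>u\<in>S. x u * (\<Sum>v\<in>nb S u. x v))"

subsection \<open>Dense families of cliques\<close>

lemma finite_nb: "finite S \<Longrightarrow> finite (nb S u)" and finite_nnb: "finite S \<Longrightarrow> finite (nnb S u)"
  by (simp_all add: nb_def nnb_def)

lemma card_nb_nnb: "finite S \<Longrightarrow> card (nb S u) + card (nnb S u) = card S"
  by (subst card_Un_disjoint [symmetric]) (auto simp: nb_def nnb_def intro: arg_cong [where f = card])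

lemma finite_cliques: "finite S \<Longrightarrow> finite (cliques k S)"
  by (rule finite_subset [OF _ finite_lists_length_eq [of S k]]) (auto simp: cliques_def)

lemma card_cliques_le: "finite S \<Longrightarrow> card (cliques k S) \<le> card S ^ k"
  using card_mono [OF finite_lists_length_eq [of S k], of "cliques k S"]
  by (auto simp: cliques_def card_lists_length_eq)

lemma Cons_in_cliques:
  "v # xs \<in> cliques (Suc k) S \<longleftrightarrow> v \<in> S \<and> xs \<in> cliques k S \<and> (\<forall>y\<in>set xs. E v y)"
  by (auto simp: cliques_def)

lemma cliques_SucE:
  assumes "ys \<in> cliques (Suc k) S"
  obtains v xs where "ys = v # xs" "v \<in> S" "xs \<in> cliques k S" "\<forall>y\<in>set xs. E v y"
  using assms by (cases ys) (auto simp: cliques_def)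

lemma card_Cons_fibres:
  assumes "finite S" "M \<subseteq> cliques (Suc k) S"
  shows "card M = (\<Sum>xs\<in>cliques k S. card {v \<in> S. v # xs \<in> M})"
proof -
  have M: "M = (\<lambda>(xs, v). v # xs) ` (SIGMA xs:cliques k S. {v \<in> S. v # xs \<in> M})" (is "_ = ?f ` ?A")
  proof (intro equalityI subsetI)
    fix ys assume "ys \<in> M"
    then obtain v xs where "ys = v # xs" "v \<in> S" "xs \<in> cliques k S"
      using assms(2) cliques_SucE by blast
    with \<open>ys \<in> M\<close> show "ys \<in> ?f ` ?A" by (auto intro!: image_eqI [of _ _ "(xs, v)"])
  qed auto
  have "inj_on ?f ?A" by (auto simp: inj_on_def)
  then have "card M = card ?A" by (subst M) (rule card_image)
  also have "\<dots> = (\<Sum>xs\<in>cliques k S. card {v \<in> S. v # xs \<in> M})"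
    using assms finite_cliques by (intro card_SigmaI) auto
  finally show ?thesis .
qed

text \<open>In the induction step, \<open>p = 4 q s\<close> tails with many extensions are blown up first; by averaging,
  many vertices extend at least \<open>s\<close> of these tails, and by the pigeonhole principle \<open>s\<close> of them extend
  the same tails, as there are only \<open>2\<^sup>p\<close> sets of tails.\<close>

lemma dense_cliques_blowup:
  assumes "finite S" "1 \<le> k" "M \<subseteq> cliques k S" "card S ^ k \<le> q * card M" "q * s \<le> card S"
    and "4 ^ (s * (2 ^ k * q) ^ (k - 1)) \<le> card S"
  shows "\<exists>T\<subseteq>M. card T = s \<and> (\<forall>a<k. inj_on (\<lambda>xs. xs ! a) T) \<and>
           (\<forall>xs\<in>T. \<forall>ys\<in>T. \<forall>a b. a < b \<longrightarrow> b < k \<longrightarrow> E (xs ! a) (ys ! b))"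
  using assms(2-)
proof (induction k arbitrary: M q s rule: nat_induct_at_least)
  case base
  have "0 < card S" using base(4) by (metis gr0I less_le_trans zero_less_numeral zero_less_power not_less0 le_zero_eq)
  then have "0 < q" using base(2) by (auto intro: gr0I)
  then have "s \<le> card M" using base(2,3) by (metis mult_le_cancel1 order_trans power_one_right)
  then obtain T where T: "T \<subseteq> M" "card T = s" by (meson obtain_subset_with_card_n)
  have "inj_on (\<lambda>xs. xs ! 0) M"
  proof (rule inj_onI)
    fix xs ys assume "xs \<in> M" "ys \<in> M" "xs ! 0 = ys ! 0"
    then have "length xs = 1" "length ys = 1" using base(1) by (auto simp: cliques_def)
    with \<open>xs ! 0 = ys ! 0\<close> show "xs = ys" by (auto simp: length_Suc_conv)
  qed
  then show ?case using T by (auto intro!: exI [of _ T] intro: inj_on_subset)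
next
  case (Suc k)
  define m where "m = card S"
  define p where "p = 4 * q * s"
  define deg where "deg = (\<lambda>xs. card {v \<in> S. v # xs \<in> M})"
  \<comment> \<open>Tails with at least half of the average degree \<open>m / q\<close> that the
    density of M guarantees. The other tails contribute at most half of the guaranteed size of M, so
    M' has density at least \<open>1 / (2 * q)\<close>.\<close>
  define M' where "M' = {xs \<in> cliques k S. m \<le> 2 * q * deg xs}"
  show ?case
  proof (cases "s = 0")
    case True
    then show ?thesis by (auto intro!: exI [of _ "{}"])
  next
    case False
    then have s: "0 < s" by simp
    have m: "0 < m"
      using Suc.prems(4) unfolding m_def
      by (metis gr0I less_le_trans zero_less_numeral zero_less_power not_less0 le_zero_eq)
    then have q: "0 < q" using Suc.prems(2) unfolding m_def by (auto intro: gr0I)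
    have deg_le: "deg xs \<le> m" for xs
      unfolding deg_def m_def by (rule card_mono) (use assms(1) in auto)
    \<comment> \<open>The product \<open>2 ^ k * q\<close> is invariant when k drops by one and q
      doubles, so the step only has to absorb 4 q into one factor
      \<open>2 ^ Suc k * q\<close>.\<close>
    have p_le: "p * (2 ^ k * (2 * q)) ^ (k - 1) \<le> s * (2 ^ Suc k * q) ^ k"
    proof -
      have "p * (2 ^ k * (2 * q)) ^ (k - 1) = s * ((4 * q) * (2 ^ Suc k * q) ^ (k - 1))"
        by (simp add: p_def algebra_simps)
      also have "\<dots> \<le> s * ((2 ^ Suc k * q) * (2 ^ Suc k * q) ^ (k - 1))"
      proof -
        have "(4::nat) \<le> 2 ^ Suc k" using power_increasing [of 2 "Suc k" "2::nat"] Suc.hyps by simp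
        then have "4 * q \<le> 2 ^ Suc k * q" by (rule mult_right_mono) simp
        then show ?thesis by (metis mult_le_mono1 mult_le_mono2)
      qed
      also have "\<dots> = s * (2 ^ Suc k * q) ^ k"
        using Suc.hyps by (metis power_Suc Suc_pred' less_eq_Suc_le One_nat_def)
      finally show ?thesis .
    qed
    have four_p: "4 ^ (p * (2 ^ k * (2 * q)) ^ (k - 1)) \<le> m"
      unfolding m_def
      by (rule order_trans [OF power_increasing [OF p_le]]) (use Suc.prems(4) in simp_all)
    have "p \<le> p * (2 ^ k * (2 * q)) ^ (k - 1)" using q by simp
    then have "(4::nat) ^ p \<le> 4 ^ (p * (2 ^ k * (2 * q)) ^ (k - 1))" by (intro power_increasing) auto
    from this four_p have pm: "4 ^ p \<le> m" by (rule order_trans)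
    have p_lt: "p < 2 ^ p" by (rule less_exp)
    have "2 * q * p \<le> p * p" using s by (simp add: p_def)
    also have "\<dots> \<le> 2 ^ p * 2 ^ p" using p_lt by (intro mult_mono) auto
    also have "\<dots> = 4 ^ p" by (simp flip: power_mult_distrib)
    finally have qp: "2 * q * p \<le> m" using pm by simp
    have cM: "card M = (\<Sum>xs\<in>cliques k S. deg xs)"
      unfolding deg_def by (rule card_Cons_fibres) (use assms(1) Suc.prems(1) in auto)
    have finc: "finite (cliques k S)" using assms(1) by (rule finite_cliques)
    have "2 * q * card M = (\<Sum>xs\<in>M'. 2 * q * deg xs) + (\<Sum>xs\<in>cliques k S - M'. 2 * q * deg xs)"
      unfolding cM sum_distrib_left using finc
      by (subst sum.subset_diff [of M' "cliques k S"]) (auto simp: M'_def)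
    also have "\<dots> \<le> (\<Sum>xs\<in>M'. 2 * q * m) + (\<Sum>xs\<in>cliques k S - M'. m)"
      using deg_le by (intro add_mono sum_mono) (auto simp: M'_def)
    also have "\<dots> \<le> 2 * q * m * card M' + m * m ^ k"
    proof -
      have "card (cliques k S - M') \<le> m ^ k"
        using card_mono [OF finc, of "cliques k S - M'"] card_cliques_le [OF assms(1), of k]
        by (auto simp: m_def)
      then show ?thesis by (simp add: mult.commute)
    qed
    finally have "2 * q * card M \<le> 2 * q * m * card M' + m * m ^ k" .
    moreover have "2 * (m * m ^ k) \<le> 2 * q * card M" using Suc.prems(2) by (simp add: m_def)
    ultimately have "2 * (m * m ^ k) \<le> 2 * q * m * card M' + m * m ^ k" by linarith
    then have "m * m ^ k \<le> m * (2 * q * card M')" by (simp add: algebra_simps)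
    then have "m ^ k \<le> 2 * q * card M'" using m by simp
    moreover have "M' \<subseteq> cliques k S" by (auto simp: M'_def)
    ultimately have "\<exists>T\<subseteq>M'. card T = p \<and> (\<forall>a<k. inj_on (\<lambda>xs. xs ! a) T) \<and>
        (\<forall>xs\<in>T. \<forall>ys\<in>T. \<forall>a b. a < b \<longrightarrow> b < k \<longrightarrow> E (xs ! a) (ys ! b))"
      using Suc.IH [of M' "2 * q" p] qp four_p unfolding m_def by blast
    then obtain T' where T': "T' \<subseteq> M'" "card T' = p"
      and inj: "\<forall>a<k. inj_on (\<lambda>xs. xs ! a) T'"
      and adj: "\<forall>xs\<in>T'. \<forall>ys\<in>T'. \<forall>a b. a < b \<longrightarrow> b < k \<longrightarrow> E (xs ! a) (ys ! b)"
      by (elim exE conjE) (rule that)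
    have finT': "finite T'"
      by (rule finite_subset [OF _ finc]) (use T'(1) in \<open>auto simp: M'_def\<close>)
    define N where "N = (\<lambda>v. {xs \<in> T'. v # xs \<in> M})"
    have finN: "finite (N v)" "card (N v) \<le> p" for v
      using finT' T'(2) card_mono [OF finT', of "N v"] by (auto simp: N_def)
    \<comment> \<open>Each of the p = 4 q s tails has degree at least m/(2q), so a vertex extends 2
      s tails on average; vertices extending fewer than s of them account for at most half of the
      incidences.\<close>
    define D where "D = {v \<in> S. s \<le> card (N v)}"
    have "(\<Sum>v\<in>S. card (N v)) = (\<Sum>xs\<in>T'. deg xs)"
      unfolding N_def deg_def by (rule sum_card_swap) (use finT' assms(1) in auto)
    moreover have "p * m \<le> 2 * q * (\<Sum>xs\<in>T'. deg xs)"
    proof -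
      have "(\<Sum>xs\<in>T'. m) \<le> (\<Sum>xs\<in>T'. 2 * q * deg xs)"
        using T'(1) by (intro sum_mono) (auto simp: M'_def)
      then show ?thesis using T'(2) by (simp add: sum_distrib_left)
    qed
    ultimately have "2 * q * (2 * s * m) \<le> 2 * q * (\<Sum>v\<in>S. card (N v))"
      by (simp add: p_def algebra_simps)
    then have "2 * s * m \<le> (\<Sum>v\<in>S. card (N v))" using q by (simp add: ac_simps)
    also have "\<dots> = (\<Sum>v\<in>D. card (N v)) + (\<Sum>v\<in>S - D. card (N v))"
      using assms(1) by (subst sum.subset_diff [of D S]) (auto simp: D_def)
    also have "\<dots> \<le> (\<Sum>v\<in>D. p) + (\<Sum>v\<in>S - D. s)"
      using finN by (intro add_mono sum_mono) (auto simp: D_def)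
    also have "\<dots> \<le> p * card D + s * m"
      using card_mono [OF assms(1), of "S - D"] by (auto simp: m_def mult.commute)
    finally have "s * m \<le> s * (4 * q * card D)" by (simp add: p_def algebra_simps)
    then have mD: "m \<le> 4 * q * card D" using s by simp
    \<comment> \<open>The bound \<open>4 ^ p \<le> m\<close> pays for the 2^p possible sets and,
      through p < 2^p, for the factor 4 q s as well.\<close>
    have "\<exists>X\<in>Pow T'. s \<le> card {v \<in> D. N v = X}"
    proof (rule ccontr)
      assume no: "\<not> ?thesis"
      have "N v \<in> Pow T'" for v by (auto simp: N_def)
      then have "D = (\<Union>X\<in>Pow T'. {v \<in> D. N v = X})" by blast
      then have "card D \<le> (\<Sum>X\<in>Pow T'. card {v \<in> D. N v = X})"
        using card_UN_le [of "Pow T'" "\<lambda>X. {v \<in> D. N v = X}"] finT' by simp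
      also have "\<dots> \<le> (\<Sum>X\<in>Pow T'. s)"
      proof (rule sum_mono)
        fix X assume "X \<in> Pow T'"
        with no have "\<not> s \<le> card {v \<in> D. N v = X}" by blast
        then show "card {v \<in> D. N v = X} \<le> s" by simp
      qed
      also have "\<dots> = s * 2 ^ p" using T'(2) finT' by (simp add: card_Pow)
      finally have "m \<le> 4 * q * (s * 2 ^ p)" using mD by (meson le_trans mult_le_mono2)
      also have "\<dots> = p * 2 ^ p" by (simp add: p_def)
      also have "\<dots> < 2 ^ p * 2 ^ p" using p_lt by simp
      also have "\<dots> = 4 ^ p" by (simp flip: power_mult_distrib)
      finally show False using pm by simp
    qed
    then obtain X where X: "X \<subseteq> T'" "s \<le> card {v \<in> D. N v = X}" by auto
    obtain Y where Y: "Y \<subseteq> {v \<in> D. N v = X}" "card Y = s" "finite Y"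
      using X(2) by (meson obtain_subset_with_card_n)
    have "Y \<noteq> {}" using Y s by auto
    then have "s \<le> card X" using Y(1) by (auto simp: D_def)
    then obtain Z where Z: "Z \<subseteq> X" "card Z = s" "finite Z"
      by (meson obtain_subset_with_card_n)
    \<comment> \<open>Every vertex of Y extends every tail of Z, so any bijection will do; giving
      each tail its own head keeps the heads distinct.\<close>
    obtain h where h: "bij_betw h Z Y" using Y Z by (metis finite_same_card_bij)
    have inM: "v # xs \<in> M" if "v \<in> Y" "xs \<in> Z" for v xs
      using that Y(1) Z(1) by (auto simp: N_def)
    have hY: "h xs \<in> Y" if "xs \<in> Z" for xs using h that by (auto simp: bij_betw_def)
    have inj_h: "inj_on h Z" using h by (auto simp: bij_betw_def)
    define T where "T = (\<lambda>xs. h xs # xs) ` Z"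
    have ZT': "Z \<subseteq> T'" using Z X by simp
    have "T \<subseteq> M" using inM hY by (auto simp: T_def)
    moreover have "card T = s" unfolding T_def using Z(2) by (subst card_image) (auto simp: inj_on_def)
    moreover have "inj_on (\<lambda>xs. xs ! a) T" if "a < Suc k" for a
    proof (cases a)
      case 0
      then show ?thesis using inj_h by (auto simp: T_def inj_on_def)
    next
      case (Suc a')
      then show ?thesis using inj [rule_format, of a'] that ZT' by (auto simp: T_def inj_on_def subset_iff)
    qed
    moreover have "E (xs ! a) (ys ! b)" if xy: "xs \<in> T" "ys \<in> T" and ab: "a < b" "b < Suc k" for xs ys a b
    proof -
      obtain x y where x: "xs = h x # x" "x \<in> Z" and y: "ys = h y # y" "y \<in> Z"
        using xy by (auto simp: T_def)
      obtain b' where b': "b = Suc b'" using ab by (cases b) auto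
      show ?thesis
      proof (cases a)
        case 0
        have hxy: "h x # y \<in> cliques (Suc k) S" using inM hY x(2) y(2) Suc.prems(1) by blast
        then have "y ! b' \<in> set y" using ab b' by (auto simp: cliques_def)
        then show ?thesis using hxy 0 b' x y by (auto simp: Cons_in_cliques)
      next
        case (Suc a')
        then show ?thesis using adj [rule_format, of x y a' b'] x y ZT' ab b' by auto
      qed
    qed
    ultimately show ?thesis by blast
  qed
qed

subsection \<open>The Perron vector\<close>

text \<open>In the symmetric double sum the row and the column of v contribute equally, and the
  diagonal term vanishes because there are no loops.\<close>

lemma qform_Diff_singleton:
  assumes "finite S" "v \<in> S"
  shows "qform (S - {v}) x = qform S x - 2 * x v * (\<Sum>w\<in>nb S v. x w)"
proof -
  have *: "qform T x = (\<Sum>u\<in>T. \<Sum>w\<in>T. if E u w then x u * x w else 0)" if "finite T" for T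
    unfolding qform_def nb_def using that by (auto simp: sum_distrib_left sum.inter_filter intro!: sum.cong)
  define f where "f = (\<lambda>u w. if E u w then x u * x w else 0)"
  have S: "S = insert v (S - {v})" using assms by auto
  have fvv: "f v v = 0" by (simp add: f_def E_irrefl)
  have fsym: "f u w = f w u" for u w by (auto simp: f_def E_sym)
  have fv: "(\<Sum>w\<in>S - {v}. f v w) = x v * (\<Sum>w\<in>nb S v. x w)"
  proof -
    have "(\<Sum>w\<in>S - {v}. f v w) = (\<Sum>w\<in>S. f v w)"
      using assms fvv sum.remove [of S v "f v"] by simp
    also have "\<dots> = x v * (\<Sum>w\<in>nb S v. x w)"
      unfolding f_def nb_def using assms(1)
      by (auto simp: sum_distrib_left sum.inter_filter intro!: sum.cong)
    finally show ?thesis .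
  qed
  have "qform S x = (\<Sum>u\<in>S. \<Sum>w\<in>S. f u w)" using * [OF assms(1)] by (simp add: f_def)
  also have "\<dots> = (\<Sum>w\<in>S. f v w) + (\<Sum>u\<in>S - {v}. \<Sum>w\<in>S. f u w)"
    using assms by (subst sum.remove [of S v]) auto
  also have "(\<Sum>u\<in>S - {v}. \<Sum>w\<in>S. f u w) = (\<Sum>u\<in>S - {v}. f u v + (\<Sum>w\<in>S - {v}. f u w))"
    using assms by (intro sum.cong refl) (auto simp: sum.remove [of S v])
  also have "(\<Sum>w\<in>S. f v w) = (\<Sum>w\<in>S - {v}. f v w)"
    using assms fvv sum.remove [of S v "f v"] by simp
  also have "(\<Sum>u\<in>S - {v}. f u v + (\<Sum>w\<in>S - {v}. f u w)) = (\<Sum>w\<in>S - {v}. f v w) + qform (S - {v}) x"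
    using * [of "S - {v}"] assms fsym [of _ v] by (simp add: sum.distrib f_def)
  finally show ?thesis using fv by simp
qed

lemma qform_le_abs: "qform S x \<le> qform S (\<lambda>u. \<bar>x u\<bar>)"
proof -
  have "x u * (\<Sum>v\<in>nb S u. x v) \<le> \<bar>x u\<bar> * (\<Sum>v\<in>nb S u. \<bar>x v\<bar>)" for u
    by (rule order_trans [OF abs_ge_self]) (simp add: abs_mult mult_left_mono sum_abs)
  then show ?thesis unfolding qform_def by (intro sum_mono)
qed

lemma qform_scale: "qform S (\<lambda>u. c * x u) = c\<^sup>2 * qform S x"
  unfolding qform_def by (simp add: sum_distrib_left power2_eq_square algebra_simps)

lemma qform_cong: "(\<And>u. u \<in> S \<Longrightarrow> x u = y u) \<Longrightarrow> qform S x = qform S y"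
  unfolding qform_def nb_def by (intro sum.cong arg_cong2 [where f = "(*)"]) auto

lemma qform_nonneg: "(\<And>u. u \<in> S \<Longrightarrow> 0 \<le> x u) \<Longrightarrow> 0 \<le> qform S x"
  unfolding qform_def nb_def by (intro sum_nonneg mult_nonneg_nonneg) auto

text \<open>No term in t^2 appears because the diagonal is zero. This first variation is what yields
  the eigenvalue equation at a maximiser.\<close>

lemma qform_perturb:
  assumes "finite S" "u \<in> S"
  shows "qform S (x(u := x u + t)) = qform S x + 2 * t * (\<Sum>v\<in>nb S u. x v)"
proof -
  let ?y = "x(u := x u + t)"
  have "qform (S - {u}) ?y = qform (S - {u}) x" by (rule qform_cong) auto
  moreover have "(\<Sum>v\<in>nb S u. ?y v) = (\<Sum>v\<in>nb S u. x v)"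
    by (intro sum.cong) (auto simp: nb_def E_irrefl)
  ultimately show ?thesis
    using qform_Diff_singleton [OF assms, of ?y] qform_Diff_singleton [OF assms, of x]
    by (simp add: algebra_simps)
qed

text \<open>The last conjunct makes l the maximum of the Rayleigh quotient. Nonnegativity is stated
  for all vertices, so sums over any set need no membership argument.\<close>

definition is_perron :: "'a set \<Rightarrow> real \<Rightarrow> ('a \<Rightarrow> real) \<Rightarrow> bool" where
  "is_perron S l x \<longleftrightarrow> (\<forall>u. 0 \<le> x u) \<and> (\<Sum>u\<in>S. (x u)\<^sup>2) = 1 \<and> qform S x = l \<and>
     (\<forall>u\<in>S. (\<Sum>v\<in>nb S u. x v) = l * x u) \<and> (\<forall>y. qform S y \<le> l * (\<Sum>u\<in>S. (y u)\<^sup>2))"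

text \<open>Passing to absolute values does not decrease the form, so a maximiser over nonnegative
  unit vectors is a maximiser over all; varying one coordinate at a time then gives the eigenvalue
  equation.\<close>

lemma perron_exists:
  assumes "finite S" "S \<noteq> {}"
  shows "\<exists>l x. is_perron S l x"
proof -
  \<comment> \<open>Pinning the coordinates outside S to 0 makes the box a product of compact sets
    even when the vertex type is infinite.\<close>
  define B where "B = (\<Pi>\<^sub>E i\<in>UNIV. if i \<in> S then {0..1::real} else {0})"
  define K where "K = B \<inter> {x. (\<Sum>u\<in>S. (x u)\<^sup>2) = 1}"
  have "compactin (product_topology (\<lambda>i::'a. euclidean) UNIV) B"
    unfolding B_def compactin_PiE by auto
  then have "compact B" by (simp add: euclidean_product_topology)
  have coord: "continuous_on UNIV (\<lambda>x::'a \<Rightarrow> real. x i)" for i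
    by (rule continuous_on_product_coordinates)
  have "continuous_on UNIV (\<lambda>x. \<Sum>u\<in>S. (x u :: real)\<^sup>2)"
    by (intro continuous_intros coord)
  then have "closed {x. (\<Sum>u\<in>S. (x u :: real)\<^sup>2) = 1}"
    by (intro closed_Collect_eq continuous_on_const)
  with \<open>compact B\<close> have "compact K" unfolding K_def by (rule compact_Int_closed)
  moreover have "K \<noteq> {}"
  proof -
    obtain u where "u \<in> S" using assms by auto
    have "(\<Sum>w\<in>S. (if w = u then 1 else (0::real))\<^sup>2) = (\<Sum>w\<in>S. if w = u then 1 else 0)"
      by (intro sum.cong) auto
    then have "(\<lambda>w. if w = u then 1 else 0) \<in> K"
      using \<open>u \<in> S\<close> assms(1) by (auto simp: K_def B_def PiE_iff)
    then show ?thesis by auto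
  qed
  moreover have "continuous_on K (qform S)"
  proof -
    have "continuous_on UNIV (\<lambda>x. \<Sum>u\<in>S. x u * (\<Sum>v\<in>nb S u. x v :: real))"
      by (intro continuous_intros coord)
    then show ?thesis unfolding qform_def [abs_def] by (rule continuous_on_subset) simp
  qed
  ultimately obtain x where x: "x \<in> K" and max: "\<And>y. y \<in> K \<Longrightarrow> qform S y \<le> qform S x"
    using continuous_attains_sup [of K "qform S"] by auto
  define l where "l = qform S x"
  have xB: "x \<in> B" and norm: "(\<Sum>u\<in>S. (x u)\<^sup>2) = 1" using x by (auto simp: K_def)
  have xBi: "x u \<in> (if u \<in> S then {0..1} else {0})" for u using xB by (auto simp: B_def PiE_iff)
  have nonneg: "0 \<le> x u" for u using xBi [of u] by (auto split: if_splits)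
  have l0: "0 \<le> l" unfolding l_def using nonneg by (intro qform_nonneg)
  have ray: "qform S y \<le> l * (\<Sum>u\<in>S. (y u)\<^sup>2)" for y
  proof (cases "(\<Sum>u\<in>S. (y u)\<^sup>2) = 0")
    case True
    then have "\<And>u. u \<in> S \<Longrightarrow> y u = 0" using assms(1) by (simp add: sum_nonneg_eq_0_iff)
    then have "qform S y = 0" by (simp add: qform_def)
    then show ?thesis using True by simp
  next
    case False
    define q where "q = (\<Sum>u\<in>S. (y u)\<^sup>2)"
    have q: "0 < q" using False sum_nonneg [of S "\<lambda>u. (y u)\<^sup>2"] unfolding q_def by auto
    define z where "z = (\<lambda>u. if u \<in> S then (1 / sqrt q) * \<bar>y u\<bar> else 0)"
    have zs: "(z u)\<^sup>2 = (y u)\<^sup>2 / q" if "u \<in> S" for u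
      using that q by (simp add: z_def power_mult_distrib power_divide)
    have "(\<Sum>u\<in>S. (z u)\<^sup>2) = (\<Sum>u\<in>S. (y u)\<^sup>2 / q)" by (intro sum.cong refl zs)
    also have "\<dots> = q / q" by (simp add: q_def flip: sum_divide_distrib)
    finally have z1: "(\<Sum>u\<in>S. (z u)\<^sup>2) = 1" using q by simp
    have "z u \<le> 1" if "u \<in> S" for u
    proof -
      have "(z u)\<^sup>2 \<le> (\<Sum>u\<in>S. (z u)\<^sup>2)" using that assms(1) by (intro member_le_sum) auto
      then have "(z u)\<^sup>2 \<le> 1\<^sup>2" using z1 by simp
      then show ?thesis by (rule power2_le_imp_le) simp
    qed
    then have "z \<in> K" using z1 q by (auto simp: K_def B_def PiE_iff) (auto simp: z_def)
    then have "qform S z \<le> l" unfolding l_def by (rule max)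
    moreover have "qform S z = (1 / sqrt q)\<^sup>2 * qform S (\<lambda>u. \<bar>y u\<bar>)"
      unfolding qform_scale [symmetric] by (rule qform_cong) (simp add: z_def)
    ultimately have "qform S (\<lambda>u. \<bar>y u\<bar>) \<le> l * q" using q by (simp add: power_divide field_simps)
    then show ?thesis using qform_le_abs [of S y] unfolding q_def by linarith
  qed
  have eig: "(\<Sum>v\<in>nb S u. x v) = l * x u" if u: "u \<in> S" for u
  proof -
    define a where "a = (\<Sum>v\<in>nb S u. x v) - l * x u"
    \<comment> \<open>Optimality gives 2 t a \<le> l t^2 for every shift t. This choice turns it
      into (l + 2) t^2 \<le> 0, and the added 1 keeps the denominator positive when l = 0.\<close>
    define t where "t = a / (l + 1)"
    have "(\<Sum>w\<in>S. ((x(u := x u + t)) w)\<^sup>2) = (x u + t)\<^sup>2 + (\<Sum>w\<in>S - {u}. (x w)\<^sup>2)"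
      using assms(1) u by (subst sum.remove [of S u]) auto
    also have "\<dots> = (x u + t)\<^sup>2 + (1 - (x u)\<^sup>2)"
      using norm assms(1) u sum.remove [of S u "\<lambda>w. (x w)\<^sup>2"] by simp
    finally have "qform S (x(u := x u + t)) \<le> l * ((x u + t)\<^sup>2 + (1 - (x u)\<^sup>2))"
      using ray by metis
    then have "2 * t * a \<le> l * t\<^sup>2"
      using qform_perturb [OF assms(1) u, of x t]
      by (simp add: a_def l_def power2_eq_square algebra_simps)
    moreover have "t * (l + 1) = a" using l0 by (simp add: t_def)
    ultimately have "2 * t * (t * (l + 1)) \<le> l * t\<^sup>2" by simp
    then have "(l + 2) * t\<^sup>2 \<le> 0" by (simp add: power2_eq_square algebra_simps)
    then have "t = 0" using l0 by (simp add: mult_le_0_iff)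
    then show ?thesis using \<open>t * (l + 1) = a\<close> by (simp add: a_def)
  qed
  show ?thesis
    using nonneg norm ray eig unfolding is_perron_def l_def by blast
qed

lemma perron_le_card:
  assumes "finite S" "is_perron S l x"
  shows "l \<le> card S"
proof -
  have x: "\<And>u. 0 \<le> x u" "(\<Sum>u\<in>S. (x u)\<^sup>2) = 1" "l = qform S x"
    using assms(2) by (auto simp: is_perron_def)
  have "qform S x \<le> (\<Sum>u\<in>S. x u * (\<Sum>v\<in>S. x v))"
    unfolding qform_def using assms(1) x(1) by (intro sum_mono mult_left_mono sum_mono2) (auto simp: nb_def)
  also have "\<dots> = (\<Sum>u\<in>S. x u)\<^sup>2" by (simp add: sum_distrib_right power2_eq_square)
  also have "\<dots> \<le> card S * (\<Sum>u\<in>S. (x u)\<^sup>2)" by (rule sum_power2_le_card)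
  finally show ?thesis using x by simp
qed

subsection \<open>Deleting vertices\<close>

text \<open>The vertex \<open>v\<close> that is deleted has the smallest entry of \<open>x\<close>, whereas the small degree is that
  of \<open>u\<close>. The eigenvalue equation at \<open>u\<close> and the Cauchy--Schwarz inequality bound the smallest entry.\<close>

lemma perron_delete_vertex:
  fixes a l :: real
  assumes fin: "finite S" and per: "is_perron S l x" and "u \<in> S" "0 < l" "0 < a"
    and deg: "real (card (nb S u)) \<le> l - a * card S"
  shows "\<exists>v\<in>S. \<exists>\<sigma>\<ge>0. \<sigma> * (real (card S) * (1 + 2 * a)) \<le> 1 \<and> qform (S - {v}) x = l * (1 - 2 * \<sigma>) \<and>
           (\<Sum>w\<in>S - {v}. (x w)\<^sup>2) = 1 - \<sigma>"
proof -
  have x0: "\<And>w. 0 \<le> x w" and norm: "(\<Sum>w\<in>S. (x w)\<^sup>2) = 1" and qx: "qform S x = l"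
    and eig: "\<And>w. w \<in> S \<Longrightarrow> (\<Sum>v\<in>nb S w. x v) = l * x w"
    using per by (auto simp: is_perron_def)
  define m where "m = real (card S)"
  define d where "d = real (card (nb S u))"
  have "S \<noteq> {}" using assms by auto
  then obtain v where v: "v \<in> S" and min: "\<And>w. w \<in> S \<Longrightarrow> x v \<le> x w"
    using arg_min_if_finite [OF fin, of x] by (metis not_le_imp_less)
  define \<sigma> where "\<sigma> = (x v)\<^sup>2"
  have \<sigma>: "0 \<le> \<sigma>" "\<And>w. w \<in> S \<Longrightarrow> \<sigma> \<le> (x w)\<^sup>2"
    unfolding \<sigma>_def using min x0 by (auto intro: power_mono)
  have d: "0 \<le> d" "d \<le> m" "m - d = card (nnb S u)"
    using card_nb_nnb [OF fin, of u] unfolding d_def m_def by linarith+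
  have "l\<^sup>2 * \<sigma> \<le> (l * x u)\<^sup>2"
    using \<sigma>(2) [OF \<open>u \<in> S\<close>] by (simp add: power_mult_distrib mult_left_mono)
  also have "\<dots> \<le> d * (\<Sum>w\<in>nb S u. (x w)\<^sup>2)"
    unfolding d_def using sum_power2_le_card [of x "nb S u"] eig [OF \<open>u \<in> S\<close>] by simp
  also have "(\<Sum>w\<in>nb S u. (x w)\<^sup>2) = 1 - (\<Sum>w\<in>nnb S u. (x w)\<^sup>2)"
  proof -
    have "nb S u \<union> nnb S u = S" "nb S u \<inter> nnb S u = {}" by (auto simp: nb_def nnb_def)
    then show ?thesis
      using norm sum.union_disjoint [OF finite_nb [OF fin] finite_nnb [OF fin], of u u "\<lambda>w. (x w)\<^sup>2"] by simp
  qed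
  also have "d * (1 - (\<Sum>w\<in>nnb S u. (x w)\<^sup>2)) \<le> d * (1 - (m - d) * \<sigma>)"
  proof -
    have "(\<Sum>w\<in>nnb S u. \<sigma>) \<le> (\<Sum>w\<in>nnb S u. (x w)\<^sup>2)"
      using \<sigma>(2) by (intro sum_mono) (auto simp: nnb_def)
    then show ?thesis using d by (intro mult_left_mono) auto
  qed
  finally have key: "\<sigma> * (l\<^sup>2 + d * (m - d)) \<le> d" by (simp add: algebra_simps)
  have am: "a * m \<le> l - d" "0 \<le> a * m" using deg assms(5) by (auto simp: d_def m_def)
  \<comment> \<open>The degree gap enters through l^2 - d^2 = (l - d)(l + d), where l - d is at
    least a m and l + d is at least 2 d.\<close>
  then have "a * m * (2 * d) \<le> (l - d) * (l + d)"
    using d by (intro mult_mono) auto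
  then have "d * (m * (1 + 2 * a)) \<le> l\<^sup>2 + d * (m - d)"
    by (simp add: power2_eq_square algebra_simps)
  then have "\<sigma> * (d * (m * (1 + 2 * a))) \<le> \<sigma> * (l\<^sup>2 + d * (m - d))" using \<sigma>(1) by (rule mult_left_mono)
  with key have *: "d * (\<sigma> * (m * (1 + 2 * a))) \<le> d * 1" by (simp add: algebra_simps)
  \<comment> \<open>Cancelling d needs d > 0; for an isolated u, \<open>key\<close> reads \<sigma>
    l^2 \<le> 0 and forces \<sigma> = 0.\<close>
  have "\<sigma> * (m * (1 + 2 * a)) \<le> 1"
  proof (cases "d = 0")
    case True
    then have "\<sigma> * l\<^sup>2 \<le> 0" using key by simp
    then have "\<sigma> = 0" using \<sigma>(1) \<open>0 < l\<close> by (simp add: mult_le_0_iff)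
    then show ?thesis by simp
  next
    case False
    then show ?thesis using * d by (metis mult_le_cancel_left_pos less_eq_real_def)
  qed
  moreover have "qform (S - {v}) x = l * (1 - 2 * \<sigma>)"
    using qform_Diff_singleton [OF fin v, of x] eig [OF v] qx
    by (simp add: \<sigma>_def power2_eq_square algebra_simps)
  moreover have "(\<Sum>w\<in>S - {v}. (x w)\<^sup>2) = 1 - \<sigma>"
    using norm fin v sum.remove [of S v "\<lambda>w. (x w)\<^sup>2"] by (simp add: \<sigma>_def)
  ultimately show ?thesis using v \<sigma>(1) unfolding m_def by blast
qed

text \<open>A deletion costs a fraction 2\<sigma> of the form but also \<sigma> of the squared norm
  and one unit of the order. As \<sigma> is slightly below 1/m, the quotient by norm and order grows
  by the factor 1 + a/(m - 1), while ln(n/m) grows by at most 1/(m - 1). The old vector x remains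
  the test vector on the smaller set.\<close>

lemma potential_delete_vertex:
  fixes g a n :: real
  assumes fin: "finite S" and per: "is_perron S l x" and u: "u \<in> S"
    and a: "0 < a" "a \<le> 1/4" "2 \<le> a * card S" and g: "0 < g" and n: "card S \<le> n"
    and l: "g * (1 + a * ln (n / card S)) * card S \<le> l"
    and deg: "real (card (nb S u)) \<le> l - a * card S"
  shows "\<exists>v\<in>S. 0 < (\<Sum>w\<in>S - {v}. (x w)\<^sup>2) \<and>
           g * (1 + a * ln (n / card (S - {v}))) * card (S - {v}) * (\<Sum>w\<in>S - {v}. (x w)\<^sup>2) \<le> qform (S - {v}) x"
proof -
  define m where "m = real (card S)"
  have m: "8 \<le> m"
  proof -
    have "2 \<le> a * m" using a(3) by (simp add: m_def)
    also have "\<dots> \<le> 1/4 * m" using a by (intro mult_right_mono) (auto simp: m_def)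
    finally show ?thesis by simp
  qed
  have lnm: "0 \<le> ln (n / m)" using n m by (simp add: m_def)
  have gm: "g * m \<le> l"
  proof -
    have "g * m \<le> g * (1 + a * ln (n / m)) * m"
      using g a lnm m by (intro mult_right_mono) auto
    then show ?thesis using l by (simp add: m_def)
  qed
  have l0: "0 < l" using gm g m by (smt (verit) mult_pos_pos)
  obtain v \<sigma> where v: "v \<in> S" and \<sigma>: "0 \<le> \<sigma>" "\<sigma> * (m * (1 + 2 * a)) \<le> 1"
    and q: "qform (S - {v}) x = l * (1 - 2 * \<sigma>)" and s: "(\<Sum>w\<in>S - {v}. (x w)\<^sup>2) = 1 - \<sigma>"
    using perron_delete_vertex [OF fin per u l0 a(1) deg] unfolding m_def by auto
  have c: "real (card (S - {v})) = m - 1"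
    using v fin m by (simp add: m_def card_Diff_singleton)
  \<comment> \<open>Here 2 \<le> a m is spent: in (1 - a)(1 + 2 a) m the gain a m outweighs the loss
    2 a^2 m with at least 1 - a to spare.\<close>
  have "1 - a \<le> a * (1 - 2 * a) * m"
  proof -
    have "1/2 * 2 \<le> (1 - 2 * a) * (a * m)" using a by (intro mult_mono) (auto simp: m_def)
    then show ?thesis using a by (simp add: algebra_simps)
  qed
  then have "m + 1 - a \<le> (1 - a) * (m * (1 + 2 * a))" by (simp add: algebra_simps)
  then have "\<sigma> * (m + 1 - a) \<le> \<sigma> * ((1 - a) * (m * (1 + 2 * a)))" using \<sigma>(1) by (rule mult_left_mono)
  also have "\<dots> = (1 - a) * (\<sigma> * (m * (1 + 2 * a)))" by simp
  also have "\<dots> \<le> (1 - a) * 1" using \<sigma>(2) a by (intro mult_left_mono) auto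
  finally have step: "(m - 1 + a) * (1 - \<sigma>) \<le> m * (1 - 2 * \<sigma>)" by (simp add: algebra_simps)
  have \<sigma>1: "\<sigma> < 1"
  proof (rule ccontr)
    assume "\<not> \<sigma> < 1"
    then have "1 * (m * (1 + 2 * a)) \<le> \<sigma> * (m * (1 + 2 * a))" using m a by (intro mult_right_mono) auto
    moreover have "8 * 1 \<le> m * (1 + 2 * a)" using m a by (intro mult_mono) auto
    ultimately show False using \<sigma>(2) by linarith
  qed
  have "ln (n / (m - 1)) = ln (n / m) + ln (m / (m - 1))"
    using m n unfolding m_def [symmetric] by (simp add: ln_div)
  also have "ln (m / (m - 1)) \<le> m / (m - 1) - 1" using m by (intro ln_le_minus_one) auto
  also have "m / (m - 1) - 1 = 1 / (m - 1)" using m by (simp add: field_simps)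
  finally have "g * a * (m - 1) * ln (n / (m - 1)) \<le> g * a * (m - 1) * (ln (n / m) + 1 / (m - 1))"
    using g a m by (intro mult_left_mono) auto
  also have "\<dots> = g * a * (m - 1) * ln (n / m) + g * a" using m by (simp add: distrib_left)
  finally have "g * a * (m - 1) * ln (n / (m - 1)) \<le> g * a * (m - 1) * ln (n / m) + g * a" .
  moreover have "g * (1 + a * t) * (m - 1) = g * (m - 1) + g * a * (m - 1) * t" for t
    by (simp add: algebra_simps)
  ultimately have "g * (1 + a * ln (n / (m - 1))) * (m - 1) \<le> g * (1 + a * ln (n / m)) * (m - 1) + g * a"
    by simp
  then have "m * (g * (1 + a * ln (n / (m - 1))) * (m - 1)) \<le> m * (g * (1 + a * ln (n / m)) * (m - 1) + g * a)"
    using m by (intro mult_left_mono) auto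
  also have "\<dots> = g * (1 + a * ln (n / m)) * m * (m - 1) + g * m * a" by (simp add: algebra_simps)
  also have "\<dots> \<le> l * (m - 1) + l * a"
    using l gm m a unfolding m_def [symmetric] by (intro add_mono mult_right_mono) auto
  finally have "m * (g * (1 + a * ln (n / (m - 1))) * (m - 1)) \<le> l * (m - 1 + a)" by (simp add: algebra_simps)
  then have "m * (g * (1 + a * ln (n / (m - 1))) * (m - 1)) * (1 - \<sigma>) \<le> l * (m - 1 + a) * (1 - \<sigma>)"
    using \<sigma>1 by (intro mult_right_mono) auto
  also have "\<dots> = l * ((m - 1 + a) * (1 - \<sigma>))" by simp
  also have "\<dots> \<le> l * (m * (1 - 2 * \<sigma>))" using step l0 by (intro mult_left_mono) auto
  finally have "m * (g * (1 + a * ln (n / (m - 1))) * (m - 1) * (1 - \<sigma>)) \<le> m * (l * (1 - 2 * \<sigma>))"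
    by (simp add: algebra_simps)
  then have "g * (1 + a * ln (n / (m - 1))) * (m - 1) * (1 - \<sigma>) \<le> l * (1 - 2 * \<sigma>)" using m by simp
  then show ?thesis using v q s c \<sigma>1 by (intro bexI [of _ v]) auto
qed

text \<open>The set \<open>S\<close> is a smallest one whose ratio \<open>\<mu>/m\<close> is at least \<open>g (1 + a ln (n/m))\<close>; deleting a
  vertex of small degree would preserve this bound.\<close>

lemma spectral_core_exists:
  fixes g a :: real
  assumes fin: "finite V" and a: "0 < a" "a \<le> 1/4" and g: "1/4 \<le> g"
    and n: "2 * exp (3 / a) \<le> a * card V"
    and y: "0 < (\<Sum>u\<in>V. (y u)\<^sup>2)" "g * card V * (\<Sum>u\<in>V. (y u)\<^sup>2) \<le> qform V y"
  shows "\<exists>S l x. S \<subseteq> V \<and> S \<noteq> {} \<and> is_perron S l x \<and> g * (1 + a * ln (card V / card S)) * card S \<le> l \<and>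
           (\<forall>u\<in>S. l - a * card S < card (nb S u)) \<and> ln (card V / card S) \<le> 3 / a"
proof -
  define n where "n = real (card V)"
  \<comment> \<open>Asking only for a test vector lets the Perron vector of S, restricted, witness
    the property for S with one vertex removed.\<close>
  define P where "P = (\<lambda>S. S \<subseteq> V \<and> S \<noteq> {} \<and> (\<exists>y. 0 < (\<Sum>u\<in>S. (y u)\<^sup>2) \<and>
     g * (1 + a * ln (n / card S)) * card S * (\<Sum>u\<in>S. (y u)\<^sup>2) \<le> qform S y))"
  have V0: "V \<noteq> {}" using y(1) by auto
  have n0: "0 < n" using V0 fin by (simp add: n_def card_gt_0_iff)
  have "P V" unfolding P_def using y V0 n0 by (auto simp: n_def intro!: exI [of _ y])
  then obtain S where S: "P S" and min: "\<And>T. P T \<Longrightarrow> card S \<le> card T"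
    using ex_has_least_nat [of P V card] by auto
  have SV: "S \<subseteq> V" and S0: "S \<noteq> {}" using S by (auto simp: P_def)
  have finS: "finite S" using SV fin by (rule finite_subset)
  define m where "m = real (card S)"
  have m0: "0 < m" using S0 finS by (simp add: m_def card_gt_0_iff)
  have mn: "m \<le> n" unfolding m_def n_def using card_mono [OF fin SV] by simp
  obtain l x where per: "is_perron S l x" using perron_exists [OF finS S0] by auto
  obtain z where z: "0 < (\<Sum>u\<in>S. (z u)\<^sup>2)" "g * (1 + a * ln (n / m)) * m * (\<Sum>u\<in>S. (z u)\<^sup>2) \<le> qform S z"
    using S by (auto simp: P_def m_def)
  have "qform S z \<le> l * (\<Sum>u\<in>S. (z u)\<^sup>2)" using per by (auto simp: is_perron_def)
  with z(2) have "g * (1 + a * ln (n / m)) * m * (\<Sum>u\<in>S. (z u)\<^sup>2) \<le> l * (\<Sum>u\<in>S. (z u)\<^sup>2)" by linarith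
  then have l: "g * (1 + a * ln (n / m)) * m \<le> l" using z(1) by simp
  have lnm: "0 \<le> ln (n / m)" using mn m0 by simp
  \<comment> \<open>The trivial bound l \<le> m caps the potential at 1, so with g \<ge> 1/4 the
    logarithm cannot exceed 3/a.\<close>
  have "l \<le> m" unfolding m_def by (rule perron_le_card [OF finS per])
  with l have "g * (1 + a * ln (n / m)) * m \<le> 1 * m" by simp
  then have "g * (1 + a * ln (n / m)) \<le> 1" using m0 by simp
  moreover have "1/4 * (1 + a * ln (n / m)) \<le> g * (1 + a * ln (n / m))"
    using g a lnm by (intro mult_right_mono) auto
  ultimately have "a * ln (n / m) \<le> 3" by simp
  then have ln3: "ln (n / m) \<le> 3 / a" using a by (simp add: field_simps)
  then have "n / m \<le> exp (3 / a)" using n0 m0 by (metis divide_pos_pos exp_le_cancel_iff exp_ln)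
  then have "n \<le> exp (3 / a) * m" using m0 by (simp add: field_simps)
  \<comment> \<open>The order of V is so large that a m \<ge> 2 survives the loss of a factor
    exp(3/a); a further deletion requires this.\<close>
  then have "a * n \<le> a * (exp (3 / a) * m)" using a by (intro mult_left_mono) auto
  with n have "2 * exp (3 / a) \<le> a * (exp (3 / a) * m)" unfolding n_def by (rule order_trans)
  then have "exp (3 / a) * 2 \<le> exp (3 / a) * (a * m)" by (simp only: ac_simps)
  then have am: "2 \<le> a * m" by simp
  have "l - a * m < card (nb S u)" if u: "u \<in> S" for u
  proof (rule ccontr)
    assume "\<not> ?thesis"
    then have deg: "real (card (nb S u)) \<le> l - a * card S" by (simp add: m_def)
    obtain v where v: "v \<in> S" "0 < (\<Sum>w\<in>S - {v}. (x w)\<^sup>2)"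
       "g * (1 + a * ln (n / card (S - {v}))) * card (S - {v}) * (\<Sum>w\<in>S - {v}. (x w)\<^sup>2) \<le> qform (S - {v}) x"
      using potential_delete_vertex [OF finS per u a, of g n] am g mn l deg by (auto simp: m_def)
    moreover have "S - {v} \<noteq> {}" using v(2) by (metis sum.empty less_irrefl)
    ultimately have "P (S - {v})" unfolding P_def using SV by blast
    then have "card S \<le> card (S - {v})" by (rule min)
    moreover have "card (S - {v}) < card S" using finS v(1) by (meson card_Diff1_less)
    ultimately show False by simp
  qed
  then show ?thesis using SV S0 per l ln3 unfolding m_def n_def by blast
qed

subsection \<open>Graphs of large minimum degree\<close>

lemma clique_adjacent:
  assumes "xs \<in> cliques k S" "u \<in> set xs" "v \<in> set xs" "u \<noteq> v"
  shows "E u v"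
proof -
  obtain i j where "i < length xs" "u = xs ! i" "j < length xs" "v = xs ! j"
    using assms by (metis in_set_conv_nth)
  moreover have "sorted_wrt E xs" using assms by (simp add: cliques_def)
  ultimately show ?thesis using assms(4) E_sym
    by (metis linorder_neqE_nat sorted_wrt_nth_less)
qed

lemma distinct_clique: "xs \<in> cliques k S \<Longrightarrow> distinct xs"
proof (induction k arbitrary: xs)
  case (Suc k)
  then show ?case by (elim cliques_SucE) (auto simp: E_irrefl)
qed (simp add: cliques_def)

lemma card_common_neighbours_ge:
  fixes \<kappa> :: real
  assumes "finite S" "T \<subseteq> S" "set xs \<subseteq> S" "0 \<le> \<kappa>" "\<And>u. u \<in> S \<Longrightarrow> card (nnb S u) \<le> \<kappa>"
  shows "card T - length xs * \<kappa> \<le> card {v \<in> T. \<forall>y\<in>set xs. E v y}"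
proof -
  let ?C = "{v \<in> T. \<forall>y\<in>set xs. E v y}" and ?N = "\<Union>y\<in>set xs. nnb S y"
  have finT: "finite T" using assms by (metis finite_subset)
  have "T \<subseteq> ?C \<union> ?N" using assms(2) E_sym by (auto simp: nnb_def)
  then have "card T \<le> card (?C \<union> ?N)"
    using finT assms(1) by (intro card_mono) (auto simp: nnb_def)
  also have "\<dots> \<le> card ?C + card ?N" by (rule card_Un_le)
  also have "card ?N \<le> (\<Sum>y\<in>set xs. card (nnb S y))" by (rule card_UN_le) simp
  finally have "real (card T) \<le> card ?C + (\<Sum>y\<in>set xs. real (card (nnb S y)))"
    by (simp flip: of_nat_sum)
  also have "(\<Sum>y\<in>set xs. real (card (nnb S y))) \<le> (\<Sum>y\<in>set xs. \<kappa>)"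
    using assms by (intro sum_mono) auto
  also have "\<dots> \<le> length xs * \<kappa>"
    using assms(4) card_length [of xs] by (auto intro: mult_right_mono)
  finally show ?thesis by simp
qed

lemma cliques_extend_card:
  fixes \<kappa> f :: real
  assumes "finite S" "T \<subseteq> S" "0 \<le> \<kappa>" "\<And>u. u \<in> S \<Longrightarrow> card (nnb S u) \<le> \<kappa>"
    and "f \<le> card T - k * \<kappa>"
  shows "card (cliques k T) * f \<le> card (cliques (Suc k) T)"
proof -
  have finT: "finite T" using assms by (metis finite_subset)
  have "card (cliques k T) * f = (\<Sum>xs\<in>cliques k T. f)" by simp
  also have "\<dots> \<le> (\<Sum>xs\<in>cliques k T. real (card {v \<in> T. v # xs \<in> cliques (Suc k) T}))"
  proof (rule sum_mono)
    fix xs assume xs: "xs \<in> cliques k T"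
    then have "{v \<in> T. v # xs \<in> cliques (Suc k) T} = {v \<in> T. \<forall>y\<in>set xs. E v y}"
      by (auto simp: Cons_in_cliques)
    moreover have "card T - length xs * \<kappa> \<le> card {v \<in> T. \<forall>y\<in>set xs. E v y}"
      using xs assms by (intro card_common_neighbours_ge [of S]) (auto simp: cliques_def)
    ultimately show "f \<le> card {v \<in> T. v # xs \<in> cliques (Suc k) T}"
      using assms(5) xs by (auto simp: cliques_def)
  qed
  also have "\<dots> = card (cliques (Suc k) T)"
    using card_Cons_fibres [OF finT order_refl, of k] by simp
  finally show ?thesis .
qed

text \<open>Greedy choice: the last vertex has to avoid only k - 1 non-neighbourhoods, hence the
  extra \<kappa> on the right of the hypothesis.\<close>

lemma cliques_nonempty:
  fixes \<kappa> :: real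
  assumes "finite S" "T \<subseteq> S" "0 \<le> \<kappa>" "\<And>u. u \<in> S \<Longrightarrow> card (nnb S u) \<le> \<kappa>"
    and "k * \<kappa> < card T + \<kappa>"
  shows "cliques k T \<noteq> {}"
  using assms(5)
proof (induction k)
  case 0
  then show ?case by (auto simp: cliques_def)
next
  case (Suc k)
  then have *: "k * \<kappa> < card T" by (simp add: algebra_simps)
  then have "cliques k T \<noteq> {}" using Suc.IH assms(3) by linarith
  moreover have "finite (cliques k T)" using assms finite_cliques by (metis finite_subset)
  ultimately have "0 < card (cliques k T) * (card T - k * \<kappa>)" using * by (simp add: card_gt_0_iff)
  also have "\<dots> \<le> card (cliques (Suc k) T)" by (rule cliques_extend_card [OF assms(1-4)]) simp_all
  finally show ?case by auto
qed

text \<open>Double counting over the r(r+1) ordered pairs of clique vertices: a vertex with a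
  neighbours in the clique lies in a(a - 1) of their common neighbourhoods. The linear lower bound
  for a(a - 1) is the secant through a = r - 1 and a = r, so it is tight when every vertex misses
  one or two clique vertices, and linearity brings in the degree sum.\<close>

lemma clique_large_codegree:
  fixes \<kappa> :: real
  assumes fin: "finite S" and xs: "xs \<in> cliques (r + 1) S" and "1 \<le> r"
    and \<kappa>: "\<And>u. u \<in> S \<Longrightarrow> card S - \<kappa> \<le> card (nb S u)"
  shows "\<exists>u\<in>S. \<exists>v\<in>S. E u v \<and>
    2 * (real r - 1) * (real r + 1) * (card S - \<kappa>) - real r * (real r - 1) * card S
      \<le> real r * (real r + 1) * card (nb S u \<inter> nb S v)"
proof (rule ccontr)
  assume no: "\<not> ?thesis"
  define X where "X = 2 * (real r - 1) * (real r + 1) * (card S - \<kappa>) - real r * (real r - 1) * card S"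
  define R where "R = set xs"
  have R: "finite R" "R \<subseteq> S" "card R = r + 1"
    using xs distinct_clique [OF xs] by (auto simp: R_def cliques_def distinct_card)
  define PR where "PR = (SIGMA u:R. R - {u})"
  have PR: "finite PR" "card PR = (r + 1) * r" "PR \<noteq> {}"
  proof -
    show "finite PR" using R by (simp add: PR_def)
    show c: "card PR = (r + 1) * r" using R by (simp add: PR_def card_SigmaI)
    then show "PR \<noteq> {}" using assms(3) by auto
  qed
  define a where "a = (\<lambda>z. card {u \<in> R. E u z})"
  have pairs: "card {p \<in> PR. E (fst p) z \<and> E (snd p) z} = a z * (a z - 1)" for z
  proof -
    have "{p \<in> PR. E (fst p) z \<and> E (snd p) z} = (SIGMA u:{u \<in> R. E u z}. {u \<in> R. E u z} - {u})"
      by (auto simp: PR_def)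
    then show ?thesis using R by (simp add: card_SigmaI a_def)
  qed
  \<comment> \<open>An integer is never strictly between \<open>r - 1\<close> and \<open>r\<close>.\<close>
  have tangent: "2 * (real r - 1) * a z - real r * (real r - 1) \<le> real (a z * (a z - 1))" for z
  proof (cases "a z = 0")
    case True
    then show ?thesis using assms(3) by simp
  next
    case False
    define k where "k = int (a z)"
    have "0 \<le> (k - int r) * (k - int r + 1)" by (cases "k \<ge> int r") (auto simp: mult_nonneg_nonneg mult_nonpos_nonpos)
    then have "real_of_int 0 \<le> real_of_int ((k - int r) * (k - int r + 1))" by (simp only: of_int_le_iff)
    then have "0 \<le> (real (a z) - r) * (real (a z) - r + 1)" by (simp add: k_def)
    moreover have "real (a z * (a z - 1)) = real (a z) * (real (a z) - 1)"
      using False by (simp add: of_nat_diff)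
    ultimately show ?thesis by (simp add: algebra_simps)
  qed
  have deg: "(\<Sum>z\<in>S. a z) = (\<Sum>u\<in>R. card (nb S u))"
    unfolding a_def nb_def using fin R by (intro sum_card_swap) auto
  have "X \<le> 2 * (real r - 1) * (\<Sum>u\<in>R. real (card (nb S u))) - real r * (real r - 1) * card S"
  proof -
    have "(\<Sum>u\<in>R. card S - \<kappa>) \<le> (\<Sum>u\<in>R. real (card (nb S u)))"
      using \<kappa> R by (intro sum_mono) auto
    then have "(real r + 1) * (card S - \<kappa>) \<le> (\<Sum>u\<in>R. real (card (nb S u)))" using R by (simp add: add.commute)
    then have "2 * (real r - 1) * ((real r + 1) * (card S - \<kappa>)) \<le> 2 * (real r - 1) * (\<Sum>u\<in>R. real (card (nb S u)))"
      using assms(3) by (intro mult_left_mono) auto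
    then show ?thesis by (simp add: X_def mult.assoc)
  qed
  also have "(\<Sum>u\<in>R. real (card (nb S u))) = (\<Sum>z\<in>S. real (a z))"
    using deg by (simp flip: of_nat_sum)
  also have "2 * (real r - 1) * (\<Sum>z\<in>S. real (a z)) - real r * (real r - 1) * card S
      = (\<Sum>z\<in>S. 2 * (real r - 1) * a z - real r * (real r - 1))"
    by (simp add: sum_subtractf sum_distrib_left)
  also have "\<dots> \<le> (\<Sum>z\<in>S. real (card {p \<in> PR. E (fst p) z \<and> E (snd p) z}))"
    unfolding pairs using tangent by (intro sum_mono)
  also have "\<dots> = (\<Sum>p\<in>PR. real (card {z \<in> S. E (fst p) z \<and> E (snd p) z}))"
    using sum_card_swap [OF fin PR(1), of "\<lambda>z p. E (fst p) z \<and> E (snd p) z"] by (simp flip: of_nat_sum)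
  finally have "X \<le> (\<Sum>p\<in>PR. real (card {z \<in> S. E (fst p) z \<and> E (snd p) z}))" .
  then have "real r * (real r + 1) * X \<le> real r * (real r + 1) * (\<Sum>p\<in>PR. real (card {z \<in> S. E (fst p) z \<and> E (snd p) z}))"
    by (intro mult_left_mono) auto
  also have "\<dots> = (\<Sum>p\<in>PR. real r * (real r + 1) * real (card {z \<in> S. E (fst p) z \<and> E (snd p) z}))"
    by (simp add: sum_distrib_left)
  also have "\<dots> < (\<Sum>p\<in>PR. X)"
  proof (rule sum_strict_mono [OF PR(1,3)])
    fix p assume p: "p \<in> PR"
    have "fst p \<in> R" "snd p \<in> R" "fst p \<noteq> snd p" using p by (auto simp: PR_def)
    then have "E (fst p) (snd p)" "fst p \<in> S" "snd p \<in> S"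
      using R clique_adjacent [OF xs, of "fst p" "snd p"] by (auto simp: R_def)
    moreover have "{z \<in> S. E (fst p) z \<and> E (snd p) z} = nb S (fst p) \<inter> nb S (snd p)" by (auto simp: nb_def)
    ultimately show "real r * (real r + 1) * real (card {z \<in> S. E (fst p) z \<and> E (snd p) z}) < X"
      using no unfolding X_def [symmetric] by (auto simp: not_le)
  qed
  also have "\<dots> = real r * (real r + 1) * X" unfolding sum_constant PR(2) by (simp add: algebra_simps)
  finally show False by simp
qed

text \<open>The heads of the cliques range over S, but their tails lie in the common neighbourhood T
  of an edge uv. After the blow-up all parts except the first lie in T, so u and v can join the
  first part and supply the additional edge. The density 1/q is the product of r - 2 factors 1/r, a
  factor 1/r^3 for the last vertex found in T, and 1/(2r) for the head.\<close>

lemma clique_imp_blowup: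
  fixes \<kappa> \<eta> :: real
  assumes fin: "finite S" and m: "0 < card S" and r: "2 \<le> r"
    and \<eta>: "\<eta> = 1 / (7 * real r ^ 4)" and \<kappa>: "\<kappa> = (1 / r + \<eta>) * card S"
    and non: "\<And>u. u \<in> S \<Longrightarrow> card (nnb S u) \<le> \<kappa>"
    and clique: "cliques (r + 1) S \<noteq> {}"
    and q: "q = 2 * r ^ (r + 2)" "q * s \<le> card S" "4 ^ (s * (2 ^ r * q) ^ (r - 1)) \<le> card S"
  shows "\<exists>A u v. (\<forall>i<r. A i \<subseteq> S \<and> s \<le> card (A i)) \<and>
           (\<forall>i<r. \<forall>j<r. i \<noteq> j \<longrightarrow> (\<forall>x\<in>A i. \<forall>y\<in>A j. E x y)) \<and> u \<in> A 0 \<and> v \<in> A 0 \<and> E u v"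
proof -
  define \<rho> where "\<rho> = real r"
  define m where "m = real (card S)"
  have \<rho>: "2 \<le> \<rho>" using r by (simp add: \<rho>_def)
  have m0: "0 < m" using assms(2) by (simp add: m_def)
  have \<eta>0: "0 < \<eta>" using \<rho> by (simp add: \<eta> \<rho>_def)
  have \<kappa>m: "m / \<rho> \<le> \<kappa>" "0 < \<kappa>"
  proof -
    have "\<kappa> = m / \<rho> + \<eta> * m" by (simp add: \<kappa> m_def \<rho>_def algebra_simps)
    moreover have "0 < \<eta> * m" "0 < m / \<rho>" using \<eta>0 m0 \<rho> by simp_all
    ultimately show "m / \<rho> \<le> \<kappa>" "0 < \<kappa>" by linarith+
  qed
  have deg: "card S - \<kappa> \<le> card (nb S u)" if "u \<in> S" for u
    using non [OF that] card_nb_nnb [OF fin, of u] by linarith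
  obtain xs where "xs \<in> cliques (r + 1) S" using clique by auto
  then obtain u v where uv: "u \<in> S" "v \<in> S" "E u v"
    and big: "2 * (\<rho> - 1) * (\<rho> + 1) * (m - \<kappa>) - \<rho> * (\<rho> - 1) * m \<le> \<rho> * (\<rho> + 1) * card (nb S u \<inter> nb S v)"
    using clique_large_codegree [OF fin _ _ deg] r unfolding \<rho>_def m_def by force
  define T where "T = nb S u \<inter> nb S v"
  define t where "t = real (card T)"
  have TS: "T \<subseteq> S" by (auto simp: T_def nb_def)
  \<comment> \<open>In \<open>big\<close> the main terms leave (2/\<rho>) m, which \<eta> perturbs
    by about \<eta> \<rho>^3 m; the choice \<eta> = 1/(7 \<rho>^4) keeps enough for
    m/\<rho>^3.\<close>
  have t: "m / \<rho> ^ 3 \<le> t - (\<rho> - 2) * \<kappa>"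
  proof -
    have id: "2 * (\<rho> - 1) * (\<rho> + 1) * (m - \<kappa>) - \<rho> * (\<rho> - 1) * m - \<rho> * (\<rho> + 1) * (\<rho> - 2) * \<kappa>
       = (2 / \<rho> - \<eta> * (\<rho> ^ 3 + \<rho>\<^sup>2 - 2 * \<rho> - 2)) * m"
    proof -
      have eq: "\<rho> * \<kappa> = (1 + \<rho> * \<eta>) * m" using \<rho> by (simp add: \<kappa> m_def \<rho>_def distrib_right distrib_left)
      have "\<rho> * (2 * (\<rho> - 1) * (\<rho> + 1) * (m - \<kappa>) - \<rho> * (\<rho> - 1) * m - \<rho> * (\<rho> + 1) * (\<rho> - 2) * \<kappa>)
        = 2 * (\<rho> - 1) * (\<rho> + 1) * (\<rho> * m - \<rho> * \<kappa>) - \<rho>\<^sup>2 * (\<rho> - 1) * m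
          - \<rho> * (\<rho> + 1) * (\<rho> - 2) * (\<rho> * \<kappa>)"
        by (simp add: algebra_simps power2_eq_square)
      also have "\<dots> = (2 - \<rho> * (\<eta> * (\<rho> ^ 3 + \<rho>\<^sup>2 - 2 * \<rho> - 2))) * m"
        unfolding eq by (simp add: algebra_simps power2_eq_square power3_eq_cube)
      also have "\<dots> = \<rho> * ((2 / \<rho> - \<eta> * (\<rho> ^ 3 + \<rho>\<^sup>2 - 2 * \<rho> - 2)) * m)"
        using \<rho> by (simp add: left_diff_distrib right_diff_distrib)
      finally show ?thesis using \<rho> by simp
    qed
    have "8 * \<rho>\<^sup>2 \<le> 6 * \<rho> ^ 3 + 2 * \<rho> + 2"
    proof -
      have "2 * \<rho>\<^sup>2 \<le> \<rho> * \<rho>\<^sup>2" using \<rho> by (intro mult_right_mono) auto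
      moreover have "\<rho> * \<rho>\<^sup>2 = \<rho> ^ 3" by (simp add: power3_eq_cube power2_eq_square)
      moreover have "0 \<le> \<rho>\<^sup>2" by simp
      ultimately show ?thesis using \<rho> by linarith
    qed
    then have "(7 * \<rho> ^ 3 + 7 * \<rho>\<^sup>2) / (7 * \<rho> ^ 4) \<le> (14 * \<rho> ^ 3 - (\<rho> ^ 3 + \<rho>\<^sup>2 - 2 * \<rho> - 2)) / (7 * \<rho> ^ 4)"
      using \<rho> by (intro divide_right_mono) auto
    moreover have "(7 * \<rho> ^ 3 + 7 * \<rho>\<^sup>2) / (7 * \<rho> ^ 4) = \<rho> * (\<rho> + 1) / \<rho> ^ 3"
      using \<rho> by (simp add: field_simps eval_nat_numeral)
    moreover have "(14 * \<rho> ^ 3 - (\<rho> ^ 3 + \<rho>\<^sup>2 - 2 * \<rho> - 2)) / (7 * \<rho> ^ 4) = 2 / \<rho> - \<eta> * (\<rho> ^ 3 + \<rho>\<^sup>2 - 2 * \<rho> - 2)"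
      using \<rho> unfolding \<eta> \<rho>_def [symmetric] by (simp add: field_simps eval_nat_numeral)
    ultimately have "\<rho> * (\<rho> + 1) / \<rho> ^ 3 \<le> 2 / \<rho> - \<eta> * (\<rho> ^ 3 + \<rho>\<^sup>2 - 2 * \<rho> - 2)" by simp
    then have "\<rho> * (\<rho> + 1) / \<rho> ^ 3 * m \<le> (2 / \<rho> - \<eta> * (\<rho> ^ 3 + \<rho>\<^sup>2 - 2 * \<rho> - 2)) * m"
      using m0 by (intro mult_right_mono) auto
    also have "\<dots> \<le> \<rho> * (\<rho> + 1) * t - \<rho> * (\<rho> + 1) * (\<rho> - 2) * \<kappa>"
      using big id by (simp add: t_def T_def)
    finally have "\<rho> * (\<rho> + 1) * (m / \<rho> ^ 3) \<le> \<rho> * (\<rho> + 1) * (t - (\<rho> - 2) * \<kappa>)"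
      by (simp add: algebra_simps)
    moreover have "0 < \<rho> * (\<rho> + 1)" using \<rho> by simp
    ultimately show ?thesis by (rule mult_left_le_imp_le)
  qed
  have t0: "(\<rho> - 2) * \<kappa> \<le> t" using t m0 \<rho> by (smt (verit) divide_nonneg_nonneg zero_le_power)
  \<comment> \<open>Up to length r - 2 each extension makes at least one exclusion fewer than t can
    afford, so a whole \<kappa> \<ge> m/\<rho> of candidates remains; only the last vertex in T is
    confined to the thin margin m/\<rho>^3.\<close>
  have count: "(m / \<rho>) ^ k \<le> card (cliques k T)" if "k \<le> r - 2" for k
    using that
  proof (induction k)
    case 0
    have "cliques 0 T = {[]}" by (auto simp: cliques_def)
    then show ?case by simp
  next
    case (Suc k)
    have "real k + 3 \<le> \<rho>" using Suc.prems r unfolding \<rho>_def by linarith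
    then have "(real k + 1) * \<kappa> \<le> (\<rho> - 2) * \<kappa>" using \<kappa>m by (intro mult_right_mono) auto
    then have f: "\<kappa> \<le> t - k * \<kappa>" using t0 by (simp add: algebra_simps)
    have "(m / \<rho>) ^ Suc k = (m / \<rho>) ^ k * (m / \<rho>)" by (rule power_Suc2)
    also have "\<dots> \<le> card (cliques k T) * \<kappa>"
      using Suc \<kappa>m m0 \<rho> by (intro mult_mono) auto
    also have "\<dots> \<le> card (cliques (Suc k) T)"
      using f \<kappa>m(2) by (intro cliques_extend_card [OF fin TS _ non]) (auto simp: t_def)
    finally show ?case .
  qed
  have "(m / \<rho>) ^ (r - 2) * (m / \<rho> ^ 3) \<le> card (cliques (r - 2) T) * (m / \<rho> ^ 3)"
    using count [of "r - 2"] m0 \<rho> by (intro mult_right_mono) auto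
  also have "\<dots> \<le> card (cliques (Suc (r - 2)) T)"
    using t \<kappa>m(2) r by (intro cliques_extend_card [OF fin TS _ non]) (auto simp: t_def \<rho>_def of_nat_diff)
  also have "Suc (r - 2) = r - 1" using r by simp
  finally have c1: "(m / \<rho>) ^ (r - 2) * (m / \<rho> ^ 3) \<le> card (cliques (r - 1) T)" .
  define M where "M = {ys \<in> cliques r S. tl ys \<in> cliques (r - 1) T}"
  have sr: "Suc (r - 1) = r" using r by simp
  have ext: "m / (2 * \<rho>) \<le> m - (\<rho> - 1) * \<kappa>"
  proof -
    have "2 * (\<rho> - 1) * \<rho> \<le> 7 * \<rho> ^ 4"
    proof -
      have "(\<rho> - 1) * \<rho> \<le> \<rho> * \<rho>" using \<rho> by (intro mult_right_mono) auto
      moreover have "\<rho>\<^sup>2 \<le> \<rho> ^ 4" using \<rho> by (intro power_increasing) auto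
      moreover have "0 \<le> \<rho> ^ 4" by simp
      ultimately have "2 * ((\<rho> - 1) * \<rho>) \<le> 7 * \<rho> ^ 4" unfolding power2_eq_square by linarith
      then show ?thesis by (simp only: mult.assoc)
    qed
    then have "(\<rho> - 1) * \<eta> \<le> 1 / (2 * \<rho>)"
      using \<rho> unfolding \<eta> \<rho>_def [symmetric] by (simp add: field_simps)
    then have "(\<rho> - 1) * \<eta> * m \<le> 1 / (2 * \<rho>) * m" using m0 by (intro mult_right_mono) auto
    moreover have "m - (\<rho> - 1) * \<kappa> = m / \<rho> - (\<rho> - 1) * \<eta> * m"
      using \<rho> unfolding \<kappa> \<rho>_def [symmetric] m_def [symmetric] by (simp add: field_simps)
    moreover have "m / \<rho> = 1 / (2 * \<rho>) * m + m / (2 * \<rho>)" using \<rho> by (simp add: field_simps)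
    ultimately show ?thesis by linarith
  qed
  have "card (cliques (r - 1) T) * (m / (2 * \<rho>)) = (\<Sum>xs\<in>cliques (r - 1) T. m / (2 * \<rho>))" by simp
  also have "\<dots> \<le> (\<Sum>xs\<in>cliques (r - 1) T. real (card {w \<in> S. w # xs \<in> M}))"
  proof (rule sum_mono)
    fix xs assume xs: "xs \<in> cliques (r - 1) T"
    then have xsS: "xs \<in> cliques (r - 1) S" using TS by (auto simp: cliques_def)
    have "w # xs \<in> M \<longleftrightarrow> w \<in> S \<and> (\<forall>y\<in>set xs. E w y)" for w
      using xs xsS Cons_in_cliques [of w xs "r - 1" S] unfolding sr M_def by auto
    then have "{w \<in> S. w # xs \<in> M} = {w \<in> S. \<forall>y\<in>set xs. E w y}" by auto
    moreover have "card S - length xs * \<kappa> \<le> card {w \<in> S. \<forall>y\<in>set xs. E w y}"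
      using xsS \<kappa>m by (intro card_common_neighbours_ge [OF fin order_refl _ _ non]) (auto simp: cliques_def)
    moreover have "real (length xs) = \<rho> - 1" using xs r by (auto simp: cliques_def \<rho>_def of_nat_diff)
    ultimately show "m / (2 * \<rho>) \<le> card {w \<in> S. w # xs \<in> M}" using ext by (simp add: m_def)
  qed
  also have "\<dots> \<le> (\<Sum>xs\<in>cliques (r - 1) S. real (card {w \<in> S. w # xs \<in> M}))"
    using TS fin finite_cliques by (intro sum_mono2) (auto simp: cliques_def)
  also have "\<dots> = card M"
    using card_Cons_fibres [OF fin, of M "r - 1"] unfolding sr by (auto simp: M_def)
  finally have c2: "card (cliques (r - 1) T) * (m / (2 * \<rho>)) \<le> card M" .
  have "(m / \<rho>) ^ (r - 2) * (m / \<rho> ^ 3) * (m / (2 * \<rho>)) \<le> card (cliques (r - 1) T) * (m / (2 * \<rho>))"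
    using c1 m0 \<rho> by (intro mult_right_mono) auto
  also note c2
  finally have "(m / \<rho>) ^ (r - 2) * (m / \<rho> ^ 3) * (m / (2 * \<rho>)) \<le> card M" .
  moreover have "(m / \<rho>) ^ (r - 2) * (m / \<rho> ^ 3) * (m / (2 * \<rho>)) = m ^ r / real q"
  proof -
    have e: "r - 2 + 1 + 1 = r" "r - 2 + 3 + 1 = r + 2" using r by simp_all
    have "m ^ (r - 2) * m * m = m ^ (r - 2 + 1 + 1)" by (simp only: power_add power_one_right)
    then have "m ^ r = m ^ (r - 2) * m * m" unfolding e by simp
    moreover have "\<rho> ^ (r - 2) * \<rho> ^ 3 * \<rho> = \<rho> ^ (r - 2 + 3 + 1)" by (simp only: power_add power_one_right)
    then have "\<rho> ^ (r - 2) * \<rho> ^ 3 * \<rho> = \<rho> ^ (r + 2)" unfolding e .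
    then have "real q = 2 * (\<rho> ^ (r - 2) * \<rho> ^ 3 * \<rho>)"
      by (simp only: q(1) \<rho>_def of_nat_mult of_nat_power of_nat_numeral)
    ultimately show ?thesis by (simp add: power_divide)
  qed
  moreover have "0 < real q" using r by (simp add: q(1))
  ultimately have "m ^ r \<le> q * card M" by (simp add: pos_divide_le_eq mult.commute)
  then have dens: "card S ^ r \<le> q * card M" unfolding m_def by (simp flip: of_nat_power of_nat_mult)
  obtain B where B: "B \<subseteq> M" "card B = s" and inj: "\<forall>a<r. inj_on (\<lambda>xs. xs ! a) B"
    and adj: "\<forall>xs\<in>B. \<forall>ys\<in>B. \<forall>a b. a < b \<longrightarrow> b < r \<longrightarrow> E (xs ! a) (ys ! b)"
  proof -
    have "\<exists>B\<subseteq>M. card B = s \<and> (\<forall>a<r. inj_on (\<lambda>xs. xs ! a) B) \<and>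
           (\<forall>xs\<in>B. \<forall>ys\<in>B. \<forall>a b. a < b \<longrightarrow> b < r \<longrightarrow> E (xs ! a) (ys ! b))"
      by (rule dense_cliques_blowup [OF fin _ _ dens q(2,3)]) (use r in \<open>auto simp: M_def\<close>)
    then show ?thesis by (elim exE conjE) (rule that)
  qed
  define W where "W = (\<lambda>a. (\<lambda>xs. xs ! a) ` B)"
  have W: "W a \<subseteq> S" "card (W a) = s" if "a < r" for a
  proof -
    show "W a \<subseteq> S" using that B by (auto simp: W_def M_def cliques_def subset_iff)
    show "card (W a) = s" unfolding W_def using that inj B by (simp add: card_image)
  qed
  have WT: "W (Suc a) \<subseteq> T" if "Suc a < r" for a
  proof
    fix w assume "w \<in> W (Suc a)"
    then obtain ys where ys: "ys \<in> B" "w = ys ! Suc a" by (auto simp: W_def)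
    then have "ys \<in> M" using B by auto
    then have "tl ys \<in> cliques (r - 1) T" "length ys = r" by (auto simp: M_def cliques_def)
    moreover have "w = tl ys ! a" using ys(2) \<open>length ys = r\<close> that by (simp add: nth_tl)
    ultimately show "w \<in> T" using that by (auto simp: cliques_def subset_iff)
  qed
  have WE: "E x y" if "x \<in> W i" "y \<in> W j" "i < r" "j < r" "i \<noteq> j" for x y i j
  proof (cases "i < j")
    case True
    then show ?thesis using that adj by (auto simp: W_def)
  next
    case False
    then have "E y x" using that adj by (auto simp: W_def)
    then show ?thesis by (rule E_sym)
  qed
  define A where "A = (\<lambda>i. if i = 0 then insert u (insert v (W 0)) else W i)"
  have finS: "finite (A i)" if "i < r" for i
    using W [OF that] fin finite_subset [of "W i" S] by (auto simp: A_def)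
  have "A i \<subseteq> S \<and> s \<le> card (A i)" if i: "i < r" for i
  proof -
    have "W i \<subseteq> A i" by (auto simp: A_def)
    then have "s \<le> card (A i)" using card_mono [OF finS [OF i], of "W i"] W [OF i] by simp
    then show ?thesis using W [OF i] uv by (auto simp: A_def)
  qed
  moreover have "E x y" if "i < r" "j < r" "i \<noteq> j" "x \<in> A i" "y \<in> A j" for i j x y
  proof -
    have uvW: "E u y \<and> E v y" if "0 < j" "j < r" "y \<in> W j" for j y
      using WT [of "j - 1"] that by (auto simp: T_def nb_def)
    show ?thesis
      using that WE [of x i y j] uvW [of j y] uvW [of i x] E_sym
      by (auto simp: A_def split: if_splits)
  qed
  ultimately show ?thesis using uv by (intro exI [of _ A] exI [of _ u] exI [of _ v]) (auto simp: A_def)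
qed

section \<open>Colouring clique-free graphs of large minimum degree\<close>

lemma card_nb_Int_nb_le:
  fixes \<kappa> :: real
  assumes "finite S" "0 \<le> \<kappa>" "\<And>u. u \<in> S \<Longrightarrow> card (nnb S u) \<le> \<kappa>"
    and "2 \<le> r" "cliques (r + 1) S = {}" "u \<in> S" "v \<in> S" "E u v"
  shows "card (nb S u \<inter> nb S v) \<le> (real r - 2) * \<kappa>"
proof (rule ccontr)
  assume no: "\<not> ?thesis"
  have "cliques (r - 1) (nb S u \<inter> nb S v) \<noteq> {}"
  proof (rule cliques_nonempty [OF assms(1) _ assms(2,3)])
    show "real (r - 1) * \<kappa> < card (nb S u \<inter> nb S v) + \<kappa>"
      using no assms(4) by (simp add: of_nat_diff algebra_simps)
  qed (auto simp: nb_def)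
  then obtain xs where xs: "xs \<in> cliques (r - 1) (nb S u \<inter> nb S v)" by auto
  then have "v # xs \<in> cliques (Suc (r - 1)) S"
    using assms(7) by (auto simp: Cons_in_cliques) (auto simp: cliques_def nb_def)
  then have "u # v # xs \<in> cliques (Suc (Suc (r - 1))) S"
    using xs assms(6,8) by (auto simp: Cons_in_cliques [of u]) (auto simp: cliques_def nb_def)
  then show False using assms(4,5) by simp
qed

text \<open>\<open>\<omega>\<close> measures the defect of \<open>r\<close> pairwise nearly disjoint non-neighbourhoods of size at most \<open>\<kappa>\<close>
  covering \<open>S\<close>. Every vertex has nearly the same non-neighbourhood as some vertex of a fixed
  \<open>r\<close>-clique, and this assigns the classes.\<close>

lemma clique_free_imp_colouring:
  fixes \<kappa> :: real
  assumes fin: "finite S" and "S \<noteq> {}" and \<kappa>: "0 < \<kappa>" and non: "\<And>u. u \<in> S \<Longrightarrow> card (nnb S u) \<le> \<kappa>"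
    and r: "2 \<le> r" and free: "cliques (r + 1) S = {}"
    and \<omega>: "\<omega> = r * \<kappa> - card S" "real (r\<^sup>2 + r + 1) * \<omega> < \<kappa>" "real (2 * r + 3) * \<omega> < \<kappa>"
  shows "\<exists>f. (\<forall>w\<in>S. f w < r) \<and> (\<forall>w\<in>S. \<forall>w'\<in>S. f w = f w' \<longrightarrow> \<not> E w w')"
proof -
  define m where "m = real (card S)"
  define N where "N = nnb S"
  have N: "finite (N u)" "N u \<subseteq> S" "w \<in> S \<Longrightarrow> w \<in> N w" for u w
    using fin E_irrefl by (auto simp: N_def nnb_def)
  have N_le: "card (N u) \<le> \<kappa>" if "u \<in> S" for u using non that by (simp add: N_def)
  have m\<kappa>: "m = r * \<kappa> - \<omega>" using \<omega>(1) by (simp add: m_def)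
  have cover: "S \<subseteq> (\<Union>v\<in>set xs. N v)" if "xs \<in> cliques r S" for xs
  proof
    fix z assume z: "z \<in> S"
    show "z \<in> (\<Union>v\<in>set xs. N v)"
    proof (rule ccontr)
      assume "z \<notin> (\<Union>v\<in>set xs. N v)"
      then have "\<forall>v\<in>set xs. E z v" using z E_sym by (auto simp: N_def nnb_def)
      then have "z # xs \<in> cliques (Suc r) S" using z that by (simp add: Cons_in_cliques)
      then show False using free by simp
    qed
  qed
  have clique_at: "\<exists>xs. w # xs \<in> cliques r S" if w: "w \<in> S" for w
  proof -
    have "card (nb S w) + card (N w) = card S" unfolding N_def by (rule card_nb_nnb [OF fin])
    then have c: "real (card (nb S w)) = m - real (card (N w))" by (simp add: m_def)
    have "cliques (r - 1) (nb S w) \<noteq> {}"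
    proof (rule cliques_nonempty [OF fin _ less_imp_le [OF \<kappa>] non])
      \<comment> \<open>The sign of \<omega> becomes known only after \<open>N_ge\<close>, so both
        signs are treated.\<close>
      have "1 * \<omega> \<le> real (2 * r + 3) * \<omega> \<or> \<omega> < 0"
        using mult_right_mono [of 1 "real (2 * r + 3)" \<omega>] by linarith
      then have "\<omega> < \<kappa>" using \<omega>(3) \<kappa> by auto
      then show "real (r - 1) * \<kappa> < card (nb S w) + \<kappa>"
        using N_le [OF w] r unfolding c m\<kappa> by (simp add: of_nat_diff algebra_simps)
    qed (auto simp: nb_def)
    then obtain xs where "xs \<in> cliques (r - 1) (nb S w)" by auto
    then have "w # xs \<in> cliques (Suc (r - 1)) S"
      using w by (auto simp: Cons_in_cliques) (auto simp: cliques_def nb_def)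
    then show ?thesis using r by auto
  qed
  \<comment> \<open>The non-neighbourhoods of an r-clique through w cover S, and the other r - 1 of
    them have size at most \<kappa>.\<close>
  have N_ge: "\<kappa> - \<omega> \<le> card (N w)" if w: "w \<in> S" for w
  proof -
    obtain xs where xs: "w # xs \<in> cliques r S" using clique_at [OF w] by auto
    then have len: "length xs = r - 1" and xsS: "set xs \<subseteq> S" by (auto simp: cliques_def)
    have "S \<subseteq> N w \<union> (\<Union>v\<in>set xs. N v)" using cover [OF xs] by simp
    then have "card S \<le> card (N w \<union> (\<Union>v\<in>set xs. N v))" using N by (intro card_mono) auto
    also have "\<dots> \<le> card (N w) + card (\<Union>v\<in>set xs. N v)" by (rule card_Un_le)
    also have "card (\<Union>v\<in>set xs. N v) \<le> (\<Sum>v\<in>set xs. card (N v))" by (rule card_UN_le) simp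
    finally have "m \<le> card (N w) + (\<Sum>v\<in>set xs. real (card (N v)))" by (simp add: m_def flip: of_nat_sum)
    also have "(\<Sum>v\<in>set xs. real (card (N v))) \<le> (\<Sum>v\<in>set xs. \<kappa>)" using N_le xsS by (intro sum_mono) auto
    also have "\<dots> \<le> (real r - 1) * \<kappa>"
    proof -
      have "real (card (set xs)) \<le> real r - 1" using card_length [of xs] len r by (simp add: of_nat_diff)
      then show ?thesis using \<kappa> by simp
    qed
    finally show ?thesis unfolding m\<kappa> by (simp add: algebra_simps)
  qed
  \<comment> \<open>Inclusion-exclusion: the codegree of an edge is at most (r - 2) \<kappa>, and 2
    \<kappa> - m + (r - 2) \<kappa> = \<omega>.\<close>
  have N_Int: "card (N u \<inter> N v) \<le> \<omega>" if uv: "u \<in> S" "v \<in> S" "E u v" for u v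
  proof -
    have "card (nb S u \<inter> nb S v) \<le> (real r - 2) * \<kappa>"
      by (rule card_nb_Int_nb_le [OF fin less_imp_le [OF \<kappa>] non r free uv])
    moreover have "card (nb S u \<inter> nb S v) + card (N u \<union> N v) = card S"
      using fin by (subst card_Un_disjoint [symmetric])
        (auto simp: N_def nb_def nnb_def intro: arg_cong [where f = card])
    moreover have "card (N u) + card (N v) = card (N u \<union> N v) + card (N u \<inter> N v)"
      using N by (intro card_Un_Int) auto
    ultimately have "card (N u \<inter> N v) \<le> real (card (N u)) + card (N v) - m + (real r - 2) * \<kappa>"
      unfolding m_def by linarith
    moreover have "(real r - 2) * \<kappa> = r * \<kappa> - 2 * \<kappa>" by (simp add: algebra_simps)
    ultimately show ?thesis using N_le [OF uv(1)] N_le [OF uv(2)] m\<kappa> by linarith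
  qed
  have \<omega>0: "0 \<le> \<omega>"
  proof -
    obtain w where "w \<in> S" using assms(2) by auto
    then show ?thesis using N_ge [of w] N_le [of w] by linarith
  qed
  obtain K where K: "K \<in> cliques r S" using clique_at assms(2) by blast
  define v where "v = (\<lambda>i. K ! i)"
  have lenK: "length K = r" and KS: "set K \<subseteq> S" using K by (auto simp: cliques_def)
  have vS: "v i \<in> S" if "i < r" for i using that lenK KS by (auto simp: v_def)
  define M where "M = (\<lambda>i. N (v i))"
  have coverM: "\<exists>i<r. z \<in> M i" if "z \<in> S" for z
  proof -
    obtain x where "x \<in> set K" "z \<in> N x" using cover [OF K] \<open>z \<in> S\<close> by blast
    then show ?thesis using lenK by (auto simp: M_def v_def in_set_conv_nth)
  qed
  \<comment> \<open>The r sets M i cover S and have total size at most r \<kappa> = m + \<omega>, so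
    at most \<omega> vertices are covered more than once.\<close>
  define bad where "bad = {z \<in> S. 2 \<le> card {i \<in> {..<r}. z \<in> M i}}"
  have bad: "card bad \<le> \<omega>"
  proof -
    have "(\<Sum>z\<in>S. 1 + (if z \<in> bad then 1 else 0)) \<le> (\<Sum>z\<in>S. card {i \<in> {..<r}. z \<in> M i})"
    proof (rule sum_mono)
      fix z assume z: "z \<in> S"
      then have "{i \<in> {..<r}. z \<in> M i} \<noteq> {}" using coverM by auto
      then have "0 < card {i \<in> {..<r}. z \<in> M i}" by (subst card_gt_0_iff) auto
      then show "1 + (if z \<in> bad then 1 else 0) \<le> card {i \<in> {..<r}. z \<in> M i}" by (auto simp: bad_def)
    qed
    moreover have "(\<Sum>z\<in>S. 1 + (if z \<in> bad then 1 else 0)) = card S + card bad"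
    proof -
      have "{z \<in> S. z \<in> bad} = bad" by (auto simp: bad_def)
      then have "(\<Sum>z\<in>S. if z \<in> bad then 1 else 0) = card bad"
        using sum.inter_filter [OF fin, of "\<lambda>_. 1::nat" "\<lambda>z. z \<in> bad"] by simp
      then show ?thesis unfolding sum.distrib by simp
    qed
    moreover have "(\<Sum>z\<in>S. card {i \<in> {..<r}. z \<in> M i}) = (\<Sum>i<r. card {z \<in> S. z \<in> M i})"
      using fin by (intro sum_card_swap) auto
    moreover have "(\<Sum>i<r. real (card {z \<in> S. z \<in> M i})) \<le> (\<Sum>i<r. \<kappa>)"
    proof (rule sum_mono)
      fix i assume "i \<in> {..<r}"
      moreover have "{z \<in> S. z \<in> M i} = M i" using N by (auto simp: M_def)
      ultimately show "real (card {z \<in> S. z \<in> M i}) \<le> \<kappa>" using N_le vS by (simp add: M_def)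
    qed
    ultimately have 1: "card S + card bad \<le> (\<Sum>i<r. card {z \<in> S. z \<in> M i})"
      and 2: "(\<Sum>i<r. real (card {z \<in> S. z \<in> M i})) \<le> r * \<kappa>" by simp_all
    have "real (card S + card bad) \<le> (\<Sum>i<r. real (card {z \<in> S. z \<in> M i}))"
      using of_nat_mono [OF 1, where 'a = real] by (simp only: of_nat_sum)
    then have "m + card bad \<le> r * \<kappa>" using 2 by (simp add: m_def)
    then show ?thesis using m\<kappa> by simp
  qed
  have card_Diff: "real (card (A - B)) = real (card A) - real (card (A \<inter> B))" if "finite A" for A B :: "'a set"
    using that by (simp add: card_Diff_subset_Int of_nat_diff card_mono)
  \<comment> \<open>A vertex z lying in M i alone is adjacent to every other v j, so
    \<open>N_Int\<close> makes N z almost disjoint from every other M j.\<close>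
  have good_Diff: "card (N z - M i) \<le> (real r - 1) * \<omega>" if z: "z \<in> M i - bad" and i: "i < r" for z i
  proof -
    have zS: "z \<in> S" using z N by (auto simp: M_def)
    have uniq: "z \<notin> M j" if j: "j < r" "j \<noteq> i" for j
    proof
      assume "z \<in> M j"
      then have "{i, j} \<subseteq> {i \<in> {..<r}. z \<in> M i}" using z i j by auto
      then have "card {i, j} \<le> card {i \<in> {..<r}. z \<in> M i}" by (intro card_mono) auto
      then show False using z zS j by (auto simp: bad_def)
    qed
    have "N z - M i \<subseteq> (\<Union>j\<in>{..<r} - {i}. N z \<inter> M j)"
    proof
      fix y assume y: "y \<in> N z - M i"
      then obtain j where "j < r" "y \<in> M j" using coverM [of y] N(2) [of z] by auto
      with y show "y \<in> (\<Union>j\<in>{..<r} - {i}. N z \<inter> M j)" by (intro UN_I [of j]) auto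
    qed
    then have "card (N z - M i) \<le> card (\<Union>j\<in>{..<r} - {i}. N z \<inter> M j)" using N by (intro card_mono) auto
    also have "\<dots> \<le> (\<Sum>j\<in>{..<r} - {i}. card (N z \<inter> M j))" by (rule card_UN_le) simp
    finally have "card (N z - M i) \<le> (\<Sum>j\<in>{..<r} - {i}. real (card (N z \<inter> M j)))" by (simp flip: of_nat_sum)
    also have "\<dots> \<le> (\<Sum>j\<in>{..<r} - {i}. \<omega>)"
    proof (rule sum_mono)
      fix j assume j: "j \<in> {..<r} - {i}"
      then have "E z (v j)" using uniq [of j] zS E_sym by (auto simp: M_def N_def nnb_def)
      then show "card (N z \<inter> M j) \<le> \<omega>" unfolding M_def using j zS vS by (intro N_Int) auto
    qed
    also have "\<dots> = (real r - 1) * \<omega>" using i by (simp add: of_nat_diff)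
    finally show ?thesis .
  qed
  \<comment> \<open>Either w has no good neighbour in some M i, and then N w almost contains M i; or
    it has a good neighbour in every M i, whose non-neighbourhood nearly fills M i, and then N w
    meets each M i in at most (r + 1) \<omega> vertices. The latter makes N w smaller than \<kappa>
    - \<omega>, by the first smallness condition on \<omega>.\<close>
  have near_class: "\<exists>i<r. card (N w - M i) \<le> r * \<omega>" if w: "w \<in> S" for w
  proof (cases "\<exists>i<r. \<forall>z\<in>M i - bad. \<not> E w z")
    case True
    then obtain i where i: "i < r" and "\<forall>z\<in>M i - bad. \<not> E w z" by auto
    then have "M i - bad \<subseteq> N w \<inter> M i" using N by (auto simp: M_def N_def nnb_def)
    then have "card (M i - bad) \<le> card (N w \<inter> M i)" using N by (intro card_mono) auto
    moreover have "real (card (M i - bad)) \<ge> real (card (M i)) - real (card bad)"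
      using N diff_card_le_card_Diff [of bad "M i"] finite_subset [of bad S] fin by (auto simp: bad_def)
    ultimately have "real (card (N w - M i)) \<le> 2 * \<omega>"
      using card_Diff [of "N w" "M i"] N N_le [OF w] N_ge [OF vS [OF i]] bad by (simp add: M_def)
    also have "\<dots> \<le> r * \<omega>" using r \<omega>0 by (intro mult_right_mono) auto
    finally show ?thesis using i by auto
  next
    case False
    then obtain z where z: "\<And>i. i < r \<Longrightarrow> z i \<in> M i - bad \<and> E w (z i)" by metis
    have "card (N w \<inter> M i) \<le> (r + 1) * \<omega>" if i: "i < r" for i
    proof -
      have zS: "z i \<in> S" using z [OF i] N by (auto simp: M_def)
      have "N w \<inter> M i \<subseteq> (N w \<inter> N (z i)) \<union> (M i - N (z i))" by auto
      then have "card (N w \<inter> M i) \<le> card ((N w \<inter> N (z i)) \<union> (M i - N (z i)))"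
        using N by (intro card_mono) (auto simp: M_def)
      also have "\<dots> \<le> card (N w \<inter> N (z i)) + card (M i - N (z i))" by (rule card_Un_le)
      finally have "real (card (N w \<inter> M i)) \<le> card (N w \<inter> N (z i)) + real (card (M i - N (z i)))" by simp
      moreover have "card (N w \<inter> N (z i)) \<le> \<omega>" using z [OF i] w zS by (intro N_Int) auto
      moreover have "real (card (M i - N (z i))) = real (card (M i)) - real (card (N (z i))) + real (card (N (z i) - M i))"
        using N by (simp add: card_Diff M_def Int_commute)
      moreover have "card (N (z i) - M i) \<le> (real r - 1) * \<omega>" using z [OF i] i by (intro good_Diff) auto
      ultimately show ?thesis using N_le [OF vS [OF i]] N_ge [OF zS] by (simp add: M_def algebra_simps)
    qed
    then have "(\<Sum>i<r. real (card (N w \<inter> M i))) \<le> (\<Sum>i<r. (r + 1) * \<omega>)" by (intro sum_mono) auto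
    moreover have "card (N w) \<le> (\<Sum>i<r. card (N w \<inter> M i))"
    proof -
      have "N w \<subseteq> (\<Union>i<r. M i)" using coverM N(2) [of w] by (auto simp: subset_iff)
      then have "N w = (\<Union>i<r. N w \<inter> M i)" by blast
      then show ?thesis using card_UN_le [of "{..<r}" "\<lambda>i. N w \<inter> M i"] by simp
    qed
    then have "real (card (N w)) \<le> (\<Sum>i<r. real (card (N w \<inter> M i)))" by (simp flip: of_nat_sum)
    ultimately have "real (card (N w)) \<le> r * ((r + 1) * \<omega>)" by simp
    then show ?thesis using N_ge [OF w] \<omega>(2) by (simp add: power2_eq_square algebra_simps)
  qed
  then obtain f where f: "\<And>w. w \<in> S \<Longrightarrow> f w < r \<and> card (N w - M (f w)) \<le> r * \<omega>" by metis
  \<comment> \<open>Two non-neighbourhoods that nearly fill the same set of size at most \<kappa>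
    overlap in more than \<omega> vertices, whereas adjacency allows at most \<omega>. This is the
    source of the factor 2 r + 3.\<close>
  have "\<not> E w w'" if w: "w \<in> S" "w' \<in> S" and eq: "f w = f w'" for w w'
  proof
    assume E: "E w w'"
    define A where "A = M (f w)"
    have "real (card (N w \<inter> A)) \<ge> \<kappa> - \<omega> - r * \<omega>" "real (card (N w' \<inter> A)) \<ge> \<kappa> - \<omega> - r * \<omega>"
      using f [OF w(1)] f [OF w(2)] eq N_ge [OF w(1)] N_ge [OF w(2)]
        card_Diff [of "N w" A] card_Diff [of "N w'" A] N by (auto simp: A_def)
    moreover have "card (N w \<inter> A) + card (N w' \<inter> A) \<le> card A + card (N w \<inter> N w')"
    proof -
      have "card (N w \<inter> A) + card (N w' \<inter> A) = card ((N w \<inter> A) \<union> (N w' \<inter> A)) + card ((N w \<inter> A) \<inter> (N w' \<inter> A))"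
        using N by (intro card_Un_Int) auto
      moreover have "card ((N w \<inter> A) \<union> (N w' \<inter> A)) \<le> card A"
        using N by (intro card_mono) (auto simp: A_def M_def)
      moreover have "card ((N w \<inter> A) \<inter> (N w' \<inter> A)) \<le> card (N w \<inter> N w')"
        using N by (intro card_mono) auto
      ultimately show ?thesis by linarith
    qed
    then have "real (card (N w \<inter> A)) + real (card (N w' \<inter> A)) \<le> real (card A) + real (card (N w \<inter> N w'))"
      by (simp flip: of_nat_add)
    moreover have "card (N w \<inter> N w') \<le> \<omega>" by (rule N_Int [OF w E])
    moreover have "card A \<le> \<kappa>" using f [OF w(1)] vS N_le by (simp add: A_def M_def)
    ultimately have "2 * (\<kappa> - \<omega> - r * \<omega>) \<le> \<kappa> + \<omega>" by argo
    then show False using \<omega>(3) by (simp add: algebra_simps)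
  qed
  then show ?thesis using f by blast
qed

subsection \<open>Nearly extremal multipartite graphs\<close>

text \<open>The three sums of nonnegative terms measure how far \<open>w\<close> is from uniform, how far the classes are
  from having equal weight, and the weight of the missing edges between different classes.\<close>

lemma partite_weight_identity:
  fixes x w :: "'a \<Rightarrow> real" and r :: nat
  assumes fin: "finite S" and r: "0 < r" and f: "\<And>u. u \<in> S \<Longrightarrow> f u < r"
    and col: "\<And>u v. u \<in> S \<Longrightarrow> v \<in> S \<Longrightarrow> f u = f v \<Longrightarrow> \<not> E u v"
    and x: "(\<Sum>u\<in>S. (x u)\<^sup>2) = 1" and \<sigma>: "\<sigma> = (\<Sum>u\<in>S. x u)" "\<sigma> \<noteq> 0" and w: "w = (\<lambda>u. (1 / \<sigma>) * x u)"
  shows "qform S x * (1 / card S + (\<Sum>u\<in>S. (w u - 1 / card S)\<^sup>2)) =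
    1 - 1 / r - (\<Sum>i<r. ((\<Sum>u | u \<in> S \<and> f u = i. w u) - 1 / r)\<^sup>2)
      - (\<Sum>u\<in>S. w u * (\<Sum>v | v \<in> S \<and> f v \<noteq> f u \<and> \<not> E u v. w v))"
proof -
  define m where "m = real (card S)"
  define W where "W = (\<lambda>i. \<Sum>u | u \<in> S \<and> f u = i. w u)"
  have "S \<noteq> {}" using x by auto
  then have m0: "0 < m" using fin by (simp add: m_def card_gt_0_iff)
  have w1: "(\<Sum>u\<in>S. w u) = 1" using \<sigma>(2) by (simp add: w \<sigma>(1) [symmetric] flip: sum_divide_distrib)
  have "(\<Sum>u\<in>S. (w u)\<^sup>2) = (1 / \<sigma>)\<^sup>2 * (\<Sum>u\<in>S. (x u)\<^sup>2)"
    unfolding w power_mult_distrib by (simp add: sum_distrib_left)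
  then have w2: "(\<Sum>u\<in>S. (w u)\<^sup>2) = (1 / \<sigma>)\<^sup>2" using x by simp
  have "(\<Sum>u\<in>S. (w u - 1 / m)\<^sup>2) = (\<Sum>u\<in>S. (w u)\<^sup>2 - 2 / m * w u + (1 / m)\<^sup>2)"
    by (intro sum.cong refl) (simp add: power2_diff)
  also have "\<dots> = (1 / \<sigma>)\<^sup>2 - 2 / m + m * (1 / m)\<^sup>2"
    unfolding sum.distrib sum_subtractf sum_distrib_left [symmetric] w1 w2 by (simp add: m_def)
  also have "\<dots> = (1 / \<sigma>)\<^sup>2 - 1 / m" using m0 by (simp add: power2_eq_square field_simps)
  \<comment> \<open>Variance identity for weights of total 1. It expresses the factor (1/\<sigma>)^2
    between the form at x and the form at w by the order and the deviation from uniformity.\<close>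
  finally have Z: "1 / m + (\<Sum>u\<in>S. (w u - 1 / m)\<^sup>2) = (1 / \<sigma>)\<^sup>2" by simp
  have grp: "(\<Sum>i<r. \<Sum>u | u \<in> S \<and> f u = i. h u) = (\<Sum>u\<in>S. h u)" for h :: "'a \<Rightarrow> real"
    by (rule sum.group [OF fin]) (use f in auto)
  have W1: "(\<Sum>i<r. W i) = 1" unfolding W_def using grp [of w] w1 by simp
  have "(\<Sum>i<r. (W i - 1 / r)\<^sup>2) = (\<Sum>i<r. (W i)\<^sup>2 - 2 / r * W i + (1 / r)\<^sup>2)"
    by (intro sum.cong refl) (simp add: power2_diff)
  also have "\<dots> = (\<Sum>i<r. (W i)\<^sup>2) - 2 / r + r * (1 / r)\<^sup>2"
    unfolding sum.distrib sum_subtractf sum_distrib_left [symmetric] W1 by simp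
  also have "\<dots> = (\<Sum>i<r. (W i)\<^sup>2) - 1 / r" using r by (simp add: power2_eq_square field_simps)
  finally have Y: "(\<Sum>i<r. (W i)\<^sup>2) = 1 / r + (\<Sum>i<r. (W i - 1 / r)\<^sup>2)" by simp
  \<comment> \<open>Seen from u, the total weight 1 splits into neighbours, missing edges and the
    class of u, which contains no neighbour.\<close>
  have split: "(\<Sum>v\<in>nb S u. w v) + (\<Sum>v | v \<in> S \<and> f v \<noteq> f u \<and> \<not> E u v. w v) + W (f u) = 1" if u: "u \<in> S" for u
  proof -
    let ?A = "{v \<in> S. f v \<noteq> f u \<and> \<not> E u v}" and ?B = "{v \<in> S. f v = f u}"
    have "S = nb S u \<union> ?A \<union> ?B" by (auto simp: nb_def)
    then have "(\<Sum>v\<in>S. w v) = (\<Sum>v\<in>nb S u \<union> ?A \<union> ?B. w v)" by simp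
    also have "\<dots> = (\<Sum>v\<in>nb S u \<union> ?A. w v) + (\<Sum>v\<in>?B. w v)"
      using fin col [OF u] by (intro sum.union_disjoint) (auto simp: nb_def)
    also have "(\<Sum>v\<in>nb S u \<union> ?A. w v) = (\<Sum>v\<in>nb S u. w v) + (\<Sum>v\<in>?A. w v)"
      using fin by (intro sum.union_disjoint) (auto simp: nb_def)
    finally show ?thesis using w1 by (simp add: W_def)
  qed
  have "1 = (\<Sum>u\<in>S. w u * ((\<Sum>v\<in>nb S u. w v) + (\<Sum>v | v \<in> S \<and> f v \<noteq> f u \<and> \<not> E u v. w v) + W (f u)))"
    using split w1 by simp
  also have "\<dots> = qform S w + (\<Sum>u\<in>S. w u * (\<Sum>v | v \<in> S \<and> f v \<noteq> f u \<and> \<not> E u v. w v)) + (\<Sum>u\<in>S. w u * W (f u))"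
    by (simp add: qform_def distrib_left sum.distrib)
  also have "(\<Sum>u\<in>S. w u * W (f u)) = (\<Sum>i<r. (W i)\<^sup>2)"
  proof -
    have "(\<Sum>u\<in>S. w u * W (f u)) = (\<Sum>i<r. \<Sum>u | u \<in> S \<and> f u = i. w u * W (f u))"
      using grp [of "\<lambda>u. w u * W (f u)"] by simp
    also have "\<dots> = (\<Sum>i<r. (W i)\<^sup>2)"
      by (intro sum.cong refl) (auto simp: W_def power2_eq_square sum_distrib_right)
    finally show ?thesis .
  qed
  finally have "qform S w = 1 - (\<Sum>u\<in>S. w u * (\<Sum>v | v \<in> S \<and> f v \<noteq> f u \<and> \<not> E u v. w v)) - (\<Sum>i<r. (W i)\<^sup>2)"
    by simp
  moreover have "qform S w = qform S x * (1 / \<sigma>)\<^sup>2" unfolding w qform_scale by (rule mult.commute)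
  ultimately show ?thesis using Z Y unfolding W_def m_def by (simp only: ac_simps)
qed

text \<open>The lower bound on l leaves at most b for the three defects together. Small Z lets
  relative sizes replace weights, small Y then bounds the class sizes, and small X bounds the set L
  of vertices with many missing edges: each of them misses weight at least \<beta>, so L has weight
  at most b/\<beta> = \<beta>^2.\<close>

lemma partite_large_min_degree:
  fixes \<beta> b l :: real and r :: nat
  assumes fin: "finite S" and r: "2 \<le> r" and f: "\<And>u. u \<in> S \<Longrightarrow> f u < r"
    and col: "\<And>u v. u \<in> S \<Longrightarrow> v \<in> S \<Longrightarrow> f u = f v \<Longrightarrow> \<not> E u v"
    and x: "\<And>u. 0 \<le> x u" "(\<Sum>u\<in>S. (x u)\<^sup>2) = 1"
    and \<beta>: "0 < \<beta>" "10 * \<beta> * r\<^sup>2 < 1" "b = \<beta> ^ 3" and l: "qform S x = l" "(1 - 1 / r - b) * card S \<le> l"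
  shows "l \<le> (1 - 1 / r) * card S \<and> (\<exists>T\<subseteq>S. (1 - \<beta> / 10) * card S \<le> card T \<and>
           (\<forall>u\<in>T. (1 - 1 / r - 3 * \<beta>) * card S \<le> card (nb T u)))"
proof -
  define m where "m = real (card S)"
  define \<sigma> where "\<sigma> = (\<Sum>u\<in>S. x u)"
  define w where "w = (\<lambda>u. (1 / \<sigma>) * x u)"
  define V where "V = (\<lambda>i. {u \<in> S. f u = i})"
  define miss where "miss = (\<lambda>u. {v \<in> S. f v \<noteq> f u \<and> \<not> E u v})"
  define X where "X = (\<Sum>u\<in>S. w u * (\<Sum>v\<in>miss u. w v))"
  define Y where "Y = (\<Sum>i<r. ((\<Sum>u\<in>V i. w u) - 1 / r)\<^sup>2)"
  define Z where "Z = (\<Sum>u\<in>S. (w u - 1 / m)\<^sup>2)"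
  have "S \<noteq> {}" using x(2) by auto
  then have m0: "0 < m" using fin by (simp add: m_def card_gt_0_iff)
  have \<sigma>0: "0 < \<sigma>"
  proof -
    have "\<sigma> \<noteq> 0"
    proof
      assume "\<sigma> = 0"
      then have "\<forall>u\<in>S. x u = 0" unfolding \<sigma>_def using fin x(1) by (simp add: sum_nonneg_eq_0_iff)
      then show False using x(2) by simp
    qed
    moreover have "0 \<le> \<sigma>" unfolding \<sigma>_def using x(1) by (intro sum_nonneg)
    ultimately show ?thesis by simp
  qed
  have w0: "0 \<le> w u" for u using x(1) \<sigma>0 by (simp add: w_def)
  have id: "l * (1 / m + Z) = 1 - 1 / r - Y - X"
    unfolding X_def Y_def Z_def V_def miss_def m_def l(1) [symmetric]
    by (rule partite_weight_identity [OF fin _ f col x(2) \<sigma>_def _ w_def]) (use r \<sigma>0 in auto)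
  have XYZ: "0 \<le> X" "0 \<le> Y" "0 \<le> Z"
    unfolding X_def Y_def Z_def using w0 by (auto intro!: sum_nonneg mult_nonneg_nonneg)
  have r4: "4 \<le> (real r)\<^sup>2" using power_mono [of 2 "real r" 2] r by simp
  have "10 * \<beta> * 4 \<le> 10 * \<beta> * r\<^sup>2" using \<beta>(1) r4 by (intro mult_left_mono) auto
  then have \<beta>40: "\<beta> < 1 / 40" using \<beta>(2) by simp
  have \<beta>2: "\<beta>\<^sup>2 \<le> \<beta> / 40" using \<beta>(1) \<beta>40 by (simp add: power2_eq_square)
  have \<beta>2pos: "0 < \<beta>\<^sup>2" using \<beta>(1) by simp
  have b\<beta>: "b \<le> \<beta>\<^sup>2 / 40"
  proof -
    have "b = \<beta> * \<beta>\<^sup>2" by (simp add: \<beta>(3) power3_eq_cube power2_eq_square)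
    also have "\<dots> \<le> 1 / 40 * \<beta>\<^sup>2" using \<beta>40 by (intro mult_right_mono) auto
    finally show ?thesis by simp
  qed
  have b0: "0 < b" using \<beta> by simp
  have b_small: "b \<le> 1 / 1000"
  proof -
    have "\<beta>\<^sup>2 \<le> 1 / 1600" using \<beta>2 \<beta>40 by simp
    then show ?thesis using b\<beta> by simp
  qed
  define g where "g = 1 - 1 / r - b"
  have rr: "1 / real r \<le> 1 / 2" using r by simp
  have g0: "49 / 100 \<le> g" unfolding g_def using rr b_small by simp
  have lm: "l \<le> (1 - 1 / r) * m"
  proof -
    have "0 \<le> g * m" using g0 m0 by simp
    also have "\<dots> \<le> l" using l(2) by (simp add: g_def m_def)
    finally have "0 \<le> l" .
    then have "0 \<le> l * Z" using XYZ by simp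
    then have "l / m \<le> 1 - 1 / r" using id XYZ by (simp add: distrib_left)
    then show ?thesis using m0 by (simp add: divide_le_eq)
  qed
  have sum_b: "Y + X + g * (m * Z) \<le> b"
  proof -
    have "g * m * (1 / m + Z) \<le> l * (1 / m + Z)"
      using l(2) XYZ m0 unfolding g_def m_def [symmetric] by (intro mult_right_mono) auto
    moreover have "g * m * (1 / m + Z) = g + g * (m * Z)" using m0 by (simp add: distrib_left)
    ultimately show ?thesis using id unfolding g_def by linarith
  qed
  \<comment> \<open>The factor 21/10 exceeds the reciprocal of 49/100, the lower bound for g that r
    \<ge> 2 and b \<le> 1/1000 give.\<close>
  have mZ: "m * Z \<le> 21 / 10 * b"
  proof -
    have "49 / 100 * (m * Z) \<le> g * (m * Z)" using g0 m0 XYZ by (intro mult_right_mono) auto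
    then have "49 / 100 * (m * Z) \<le> b" using sum_b XYZ by linarith
    then show ?thesis using b0 by simp
  qed
  \<comment> \<open>Cauchy--Schwarz against Z: for every vertex set, weight and relative size differ
    by at most a square-root error.\<close>
  have dev: "((\<Sum>u\<in>A. w u) - card A / m)\<^sup>2 \<le> card A / m * (21 / 10 * b)" if A: "A \<subseteq> S" for A
  proof -
    have "((\<Sum>u\<in>A. w u) - card A / m)\<^sup>2 = (\<Sum>u\<in>A. w u - 1 / m)\<^sup>2" by (simp add: sum_subtractf)
    also have "\<dots> \<le> card A * (\<Sum>u\<in>A. (w u - 1 / m)\<^sup>2)" by (rule sum_power2_le_card)
    also have "\<dots> \<le> card A * Z"
      unfolding Z_def using fin A by (intro mult_left_mono sum_mono2) auto
    also have "\<dots> = card A / m * (m * Z)" using m0 by simp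
    also have "\<dots> \<le> card A / m * (21 / 10 * b)" using mZ m0 by (intro mult_left_mono) auto
    finally show ?thesis .
  qed
  have V_le: "card (V i) \<le> (1 / r + \<beta> / 2) * m" if i: "i < r" for i
  proof -
    have "((\<Sum>u\<in>V i. w u) - 1 / r)\<^sup>2 \<le> Y"
      unfolding Y_def using i by (intro member_le_sum) auto
    also have "Y \<le> b"
    proof -
      have "0 \<le> g * (m * Z)" using g0 m0 XYZ by simp
      then show ?thesis using sum_b XYZ by linarith
    qed
    also have "b \<le> (\<beta> / 6)\<^sup>2" using b\<beta> b0 by (simp add: power_divide)
    finally have 1: "\<bar>(\<Sum>u\<in>V i. w u) - 1 / r\<bar> \<le> \<beta> / 6" using \<beta>(1) by (intro abs_le_of_square) auto
    have VS: "V i \<subseteq> S" by (auto simp: V_def)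
    have "card (V i) / m \<le> 1" using card_mono [OF fin VS] m0 by (simp add: m_def)
    then have "card (V i) / m * (21 / 10 * b) \<le> 1 * (21 / 10 * b)" using b0 by (intro mult_right_mono) auto
    then have "((\<Sum>u\<in>V i. w u) - card (V i) / m)\<^sup>2 \<le> 21 / 10 * b" using dev [OF VS] by linarith
    also have "\<dots> \<le> (\<beta> / 4)\<^sup>2" using b\<beta> b0 by (simp add: power_divide)
    finally have "\<bar>(\<Sum>u\<in>V i. w u) - card (V i) / m\<bar> \<le> \<beta> / 4" using \<beta>(1) by (intro abs_le_of_square) auto
    with 1 have "card (V i) / m \<le> 1 / r + \<beta> / 2" using \<beta>(1) unfolding abs_le_iff by linarith
    then show ?thesis using m0 by (simp add: divide_le_eq)
  qed
  define L where "L = {u \<in> S. 2 * \<beta> * m \<le> card (miss u)}"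
  have missS: "miss u \<subseteq> S" for u by (auto simp: miss_def)
  have LS: "L \<subseteq> S" by (auto simp: L_def)
  \<comment> \<open>For relative size a \<ge> 2 \<beta> the squared deviation is at most a^2/8 <
    (a/2)^2, so the weight is at least a/2.\<close>
  have miss_w: "\<beta> \<le> (\<Sum>v\<in>miss u. w v)" if u: "u \<in> L" for u
  proof -
    define a where "a = card (miss u) / m"
    define p where "p = (\<Sum>v\<in>miss u. w v)"
    have a: "2 * \<beta> \<le> a" using u m0 by (simp add: L_def a_def le_divide_eq)
    have "(p - a)\<^sup>2 \<le> a * (21 / 10 * b)" using dev [OF missS [of u]] by (simp add: p_def a_def)
    moreover have "a * (21 / 10 * b) \<le> a * (a / 8)"
    proof -
      have "21 / 10 * b \<le> a / 8" using b\<beta> \<beta>2 a \<beta>(1) by linarith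
      then show ?thesis using a \<beta>(1) by (intro mult_left_mono) auto
    qed
    ultimately have *: "(p - a)\<^sup>2 \<le> a * (a / 8)" by linarith
    have "a / 2 \<le> p"
    proof (rule ccontr)
      assume "\<not> a / 2 \<le> p"
      then have "(a / 2)\<^sup>2 \<le> (a - p)\<^sup>2" using a \<beta>(1) by (intro power_mono) auto
      also have "\<dots> \<le> a * (a / 8)" using * by (simp only: power2_commute [of a p])
      finally have "a * a / 4 \<le> a * (a / 8)" by (simp add: power2_eq_square)
      then show False using a \<beta>(1) by (simp add: mult_le_0_iff)
    qed
    then show ?thesis using a by (simp add: p_def)
  qed
  have L_le: "card L / m \<le> \<beta> / 10"
  proof -
    define h where "h = card L / m"
    define p where "p = (\<Sum>u\<in>L. w u)"
    have h0: "0 \<le> h" using m0 by (simp add: h_def)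
    have "p * \<beta> = (\<Sum>u\<in>L. w u * \<beta>)" by (simp add: p_def sum_distrib_right)
    also have "\<dots> \<le> (\<Sum>u\<in>L. w u * (\<Sum>v\<in>miss u. w v))"
      using miss_w w0 by (intro sum_mono mult_left_mono) auto
    also have "\<dots> \<le> X" unfolding X_def using fin LS w0
      by (intro sum_mono2) (auto intro!: mult_nonneg_nonneg sum_nonneg)
    also have "X \<le> b"
    proof -
      have "0 \<le> g * (m * Z)" using g0 m0 XYZ by simp
      then show ?thesis using sum_b XYZ by linarith
    qed
    also have "b = \<beta>\<^sup>2 * \<beta>" by (simp add: \<beta>(3) power3_eq_cube power2_eq_square)
    finally have p: "p \<le> \<beta>\<^sup>2" using \<beta>(1) by simp
    have dh: "(p - h)\<^sup>2 \<le> h * (21 / 10 * b)" using dev [OF LS] by (simp add: p_def h_def)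
    \<comment> \<open>Otherwise h exceeds the weight p \<le> \<beta>^2 by at least h/2, and
      \<open>dev\<close> forces h/4 \<le> 21/10 b, which is far below \<beta>^2.\<close>
    have "h \<le> 3 * \<beta>\<^sup>2"
    proof (rule ccontr)
      assume "\<not> h \<le> 3 * \<beta>\<^sup>2"
      then have h3: "3 * \<beta>\<^sup>2 < h" by simp
      then have hpos: "0 < h" using \<beta>2pos by linarith
      have "h / 2 \<le> h - p" using p h3 \<beta>2pos by linarith
      then have "(h / 2)\<^sup>2 \<le> (h - p)\<^sup>2" using hpos by (intro power_mono) auto
      also have "\<dots> \<le> h * (21 / 10 * b)" using dh by (simp only: power2_commute [of h p])
      also have "(h / 2)\<^sup>2 = h * (h / 4)" by (simp add: power2_eq_square)
      finally have "h * (h / 4) \<le> h * (21 / 10 * b)" .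
      then have "h / 4 \<le> 21 / 10 * b" using hpos by simp
      then show False using h3 b\<beta> \<beta>2pos by linarith
    qed
    then show ?thesis using \<beta>2 \<beta>(1) unfolding h_def by linarith
  qed
  then have cL: "card L \<le> \<beta> / 10 * m" using m0 by (simp add: divide_le_eq)
  define T where "T = S - L"
  have "card T = card S - card L" unfolding T_def using LS fin by (meson card_Diff_subset finite_subset)
  moreover have "card L \<le> card S" using card_mono [OF fin LS] .
  ultimately have cT: "real (card T) = m - card L" by (simp add: m_def of_nat_diff)
  have "(1 - 1 / r - 3 * \<beta>) * m \<le> card (nb T u)" if u: "u \<in> T" for u
  proof -
    have uS: "u \<in> S" and uL: "u \<notin> L" using u by (auto simp: T_def)
    have "S \<subseteq> nb T u \<union> V (f u) \<union> miss u \<union> L" by (auto simp: nb_def T_def V_def miss_def)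
    then have "card S \<le> card (nb T u \<union> V (f u) \<union> miss u \<union> L)"
      using fin LS by (intro card_mono) (auto simp: nb_def T_def V_def miss_def intro: finite_subset)
    also have "\<dots> \<le> card (nb T u) + card (V (f u)) + card (miss u) + card L"
      by (meson add_le_mono1 card_Un_le order_trans)
    finally have "m \<le> real (card (nb T u)) + real (card (V (f u))) + real (card (miss u)) + real (card L)"
      unfolding m_def by linarith
    moreover have "card (miss u) \<le> 2 * \<beta> * m" using uS uL by (auto simp: L_def)
    moreover have "card (V (f u)) \<le> (1 / r + \<beta> / 2) * m" using f [OF uS] by (rule V_le)
    \<comment> \<open>The losses \<beta>/2 from the class, 2 \<beta> from missing edges and
      \<beta>/10 from L add up to 2.6 \<beta>, leaving 0.4 \<beta> to spare.\<close>
    ultimately have "m - (1 / r + \<beta> / 2) * m - 2 * \<beta> * m - \<beta> / 10 * m \<le> card (nb T u)" using cL by linarith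
    moreover have "m - (1 / r + \<beta> / 2) * m - 2 * \<beta> * m - \<beta> / 10 * m = (1 - 1 / r - 3 * \<beta>) * m + 4 / 10 * (\<beta> * m)"
      by (simp add: algebra_simps)
    moreover have "0 \<le> \<beta> * m" using \<beta>(1) m0 by simp
    ultimately show ?thesis by linarith
  qed
  moreover have "(1 - \<beta> / 10) * m \<le> card T" using cT cL by (simp add: algebra_simps)
  ultimately show ?thesis using lm unfolding m_def T_def by blast
qed

end

subsection \<open>Pair digraphs\<close>

lemma simple_graph_relation_parcs:
  assumes "pair_graph G"
  shows "simple_graph_relation (\<lambda>u v. (u, v) \<in> parcs G)"
proof -
  interpret pair_graph G by (rule assms)
  show ?thesis
  proof
    fix u v
    show "(u, v) \<in> parcs G \<Longrightarrow> (v, u) \<in> parcs G"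
      using pair_sym_arcs by (auto simp: symmetric_def dest: symD)
    show "(u, u) \<notin> parcs G" using pair_no_loops [of "(u, u)"] by auto
  qed
qed

text \<open>Distinct sets A i are disjoint because they are completely joined and there are no
  loops; hence injective choices inside each of them combine to an injective map.\<close>

lemma K_plus_embedding:
  fixes G :: "'a pair_pre_digraph"
  assumes G: "pair_graph G" and r: "1 \<le> r" and s: "2 \<le> s"
    and A: "\<forall>i<r. A i \<subseteq> pverts G \<and> s \<le> card (A i)"
    and adj: "\<forall>i<r. \<forall>j<r. i \<noteq> j \<longrightarrow> (\<forall>x\<in>A i. \<forall>y\<in>A j. (x, y) \<in> parcs G)"
    and uv: "u \<in> A 0" "v \<in> A 0" "(u, v) \<in> parcs G"
  shows "\<exists>H. subgraph (with_proj H) (with_proj G) \<and> digraph_iso (with_proj H) (with_proj (K_plus r (\<lambda>_. s)))"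
proof -
  interpret G: pair_graph G by (rule G)
  note sym = simple_graph_relation.E_sym [OF simple_graph_relation_parcs [OF G]]
  note loopfree = simple_graph_relation.E_irrefl [OF simple_graph_relation_parcs [OF G]]
  have "u \<noteq> v" using uv loopfree by auto
  have finA: "finite (A i)" if "i < r" for i using A that finite_subset [OF _ G.pair_finite_verts] by blast
  have "\<exists>h. h ` {..<s} \<subseteq> A i \<and> inj_on h {..<s} \<and> (i = 0 \<longrightarrow> h 0 = u \<and> h 1 = v)" if i: "i < r" for i
  proof (cases "i = 0")
    case False
    obtain h where "h ` {..<s} \<subseteq> A i" "inj_on h {..<s}"
      using card_le_inj [OF _ finA [OF i], of "{..<s}"] A i by auto
    then show ?thesis using False by auto
  next
    case True
    \<comment> \<open>The additional edge of \<open>K_plus\<close> joins (0, 0) and (0, 1), so these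
      go to u and v, and the rest of the first part must avoid both.\<close>
    have "card (A 0 - {u, v}) = card (A 0) - 2" using uv \<open>u \<noteq> v\<close> by (subst card_Diff_subset) auto
    then have "card {2..<s} \<le> card (A 0 - {u, v})" using A r by (auto simp: diff_le_mono)
    then obtain g where g: "g ` {2..<s} \<subseteq> A 0 - {u, v}" "inj_on g {2..<s}"
      using card_le_inj [of "{2..<s}" "A 0 - {u, v}"] finA [of 0] r by auto
    define h where "h = (\<lambda>j. if j = 0 then u else if j = Suc 0 then v else g j)"
    have gA: "g j \<in> A 0 \<and> g j \<noteq> u \<and> g j \<noteq> v" if "2 \<le> j" "j < s" for j
      using subsetD [OF g(1), of "g j"] that by auto
    have "h ` {..<s} \<subseteq> A 0" using uv gA by (auto simp: h_def)
    moreover have "inj_on h {..<s}"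
    proof (rule inj_onI)
      fix j k assume jk: "j \<in> {..<s}" "k \<in> {..<s}" "h j = h k"
      have big: "h l \<noteq> u \<and> h l \<noteq> v" if "2 \<le> l" "l < s" for l using gA [OF that] that by (auto simp: h_def)
      have small: "l = 0 \<and> h l = u \<or> l = 1 \<and> h l = v" if "\<not> 2 \<le> l" for l using that by (auto simp: h_def)
      show "j = k"
      proof (cases "2 \<le> j \<and> 2 \<le> k")
        case True
        then have "g j = g k" using jk(3) by (auto simp: h_def)
        then show ?thesis using inj_onD [OF g(2), of j k] jk True by auto
      next
        case False
        then have "\<not> 2 \<le> j" "\<not> 2 \<le> k" using big [of j] big [of k] small [of j] small [of k] jk by auto
        then show ?thesis using small [of j] small [of k] jk(3) \<open>u \<noteq> v\<close> by auto
      qed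
    qed
    moreover have "h 0 = u" "h 1 = v" by (simp_all add: h_def)
    ultimately show ?thesis using True by blast
  qed
  then obtain h where h: "\<And>i. i < r \<Longrightarrow> h i ` {..<s} \<subseteq> A i \<and> inj_on (h i) {..<s} \<and> (i = 0 \<longrightarrow> h i 0 = u \<and> h i 1 = v)"
    by metis
  have h0: "h 0 0 = u" "h 0 (Suc 0) = v" using h [of 0] r by auto
  define e where "e = (\<lambda>p. h (fst p) (snd p))"
  define K where "K = K_plus r (\<lambda>_. s)"
  have VK: "pverts K = {..<r} \<times> {..<s}" by (simp add: K_def K_plus_def)
  have eA: "e p \<in> A (fst p)" if "p \<in> pverts K" for p
  proof -
    have "fst p < r" "snd p \<in> {..<s}" using that by (auto simp: VK)
    then show ?thesis using h [of "fst p"] by (auto simp: e_def image_subset_iff)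
  qed
  have arcs: "(e p, e q) \<in> parcs G" if pq: "(p, q) \<in> parcs K" for p q
  proof -
    have "p \<in> pverts K \<and> q \<in> pverts K \<and> fst p \<noteq> fst q \<or> (p, q) = ((0, 0), (0, 1)) \<or> (p, q) = ((0, 1), (0, 0))"
      using pq unfolding VK by (auto simp: K_def K_plus_def)
    then show ?thesis
    proof (elim disjE)
      assume "p \<in> pverts K \<and> q \<in> pverts K \<and> fst p \<noteq> fst q"
      then show ?thesis using adj eA [of p] eA [of q] by (auto simp: VK)
    qed (use h0 uv(3) sym in \<open>auto simp: e_def\<close>)
  qed
  have inj: "inj_on e (pverts K)"
  proof (rule inj_onI)
    fix p q assume p: "p \<in> pverts K" and q: "q \<in> pverts K" and eq: "e p = e q"
    have "fst p = fst q"
    proof (rule ccontr)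
      assume "fst p \<noteq> fst q"
      then have "(e p, e q) \<in> parcs G" using adj eA [OF p] eA [OF q] p q by (auto simp: VK)
      then show False using loopfree eq by simp
    qed
    moreover from this have "snd p = snd q"
      using h [of "fst p"] p q eq by (auto simp: VK e_def dest: inj_onD)
    ultimately show "p = q" by (rule prod_eqI)
  qed
  interpret K: pair_graph K unfolding K_def using r s by (intro pair_graph_K_plus) auto
  define f where "f = \<lparr>iso_verts = e, iso_arcs = map_prod e e, iso_head = snd, iso_tail = fst\<rparr>"
  define H where "H = \<lparr>pverts = e ` pverts K, parcs = map_prod e e ` parcs K\<rparr>"
  have app: "app_iso f (with_proj K) = with_proj H"
    by (simp add: app_iso_def f_def H_def with_proj_def)
  have iso: "pre_digraph.digraph_isomorphism (with_proj K) f"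
    unfolding pre_digraph.digraph_isomorphism_def
  proof (intro conjI)
    show "wf_digraph (with_proj K)" by (rule K.wf_digraph_axioms)
    show "inj_on (iso_verts f) (verts (with_proj K))" using inj by (simp add: f_def)
    have "inj_on (map_prod e e) (pverts K \<times> pverts K)" using inj by (intro map_prod_inj_on)
    moreover have "parcs K \<subseteq> pverts K \<times> pverts K" using K.in_arcsD1 K.in_arcsD2 by auto
    ultimately show "inj_on (iso_arcs f) (arcs (with_proj K))" by (simp add: f_def inj_on_subset)
  qed (simp add: f_def)
  \<comment> \<open>H is built as an image of K, so f points from K to H; the claim has H first,
    hence the inverse.\<close>
  have "digraph_iso (with_proj H) (with_proj K)"
    unfolding digraph_iso_def app [symmetric]
    using K.digraph_isomorphism_invI [OF iso] pre_digraph.app_iso_inv [OF iso] by metis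
  moreover have "subgraph (with_proj H) (with_proj G)"
    unfolding subgraph_def
  proof (intro conjI)
    show "verts (with_proj H) \<subseteq> verts (with_proj G)" using eA A by (fastforce simp: H_def VK)
    show "arcs (with_proj H) \<subseteq> arcs (with_proj G)" using arcs by (auto simp: H_def)
    show "wf_digraph (with_proj G)" by (rule G.wf_digraph_axioms)
    show "wf_digraph (with_proj H)" unfolding app [symmetric] using iso by (rule K.wf_digraphI_app_iso)
    show "compatible (with_proj G) (with_proj H)" by (simp add: compatible_def)
  qed
  ultimately show ?thesis unfolding K_def by blast
qed

lemma partite_induced_subgraph:
  fixes G :: "'a pair_pre_digraph" and d :: real
  assumes G: "pair_graph G" and T: "T \<subseteq> pverts G" "T \<noteq> {}" and f: "\<And>u. u \<in> T \<Longrightarrow> f u < r"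
    and col: "\<And>u v. u \<in> T \<Longrightarrow> v \<in> T \<Longrightarrow> f u = f v \<Longrightarrow> (u, v) \<notin> parcs G"
    and deg: "\<And>u. u \<in> T \<Longrightarrow> d < card {v \<in> T. (u, v) \<in> parcs G}"
  shows "\<exists>G0. induced_subgraph (with_proj G0) (with_proj G) \<and> partite r G0 \<and> pverts G0 = T \<and> d < min_degree G0"
proof -
  interpret G: pair_graph G by (rule G)
  define G0 where "G0 = \<lparr>pverts = T, parcs = {e \<in> parcs G. fst e \<in> T \<and> snd e \<in> T}\<rparr>"
  have finT: "finite T" using T G.pair_finite_verts finite_subset by blast
  have "wf_digraph (with_proj G0)" by unfold_locales (auto simp: G0_def)
  then have "induced_subgraph (with_proj G0) (with_proj G)"
    using T G.wf_digraph_axioms by (auto simp: induced_subgraph_def subgraph_def compatible_def G0_def)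
  moreover have "partite r G0"
    unfolding partite_def
  proof (intro exI [of _ "\<lambda>i. {u \<in> T. f u = i}"] conjI)
    show "disjoint_family_on (\<lambda>i. {u \<in> T. f u = i}) {..<r}" by (auto simp: disjoint_family_on_def)
    show "(\<Union>i<r. {u \<in> T. f u = i}) = pverts G0" using f by (auto simp: G0_def)
    show "\<forall>i<r. independent_set G0 {u \<in> T. f u = i}"
      using col by (auto simp: independent_set_def G0_def)
  qed
  moreover have "d < min_degree G0"
  proof -
    have "d < out_degree (with_proj G0) u" if u: "u \<in> T" for u
    proof -
      have "out_arcs (with_proj G0) u = Pair u ` {v \<in> T. (u, v) \<in> parcs G}"
        using u by (auto simp: out_arcs_def G0_def)
      then have "out_degree (with_proj G0) u = card {v \<in> T. (u, v) \<in> parcs G}"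
        unfolding out_degree_def by (simp add: card_image inj_on_def)
      then show ?thesis using deg [OF u] by simp
    qed
    moreover have "min_degree G0 \<in> out_degree (with_proj G0) ` T"
      unfolding min_degree_def using finT T(2) by (simp add: G0_def Min_in)
    ultimately show ?thesis by auto
  qed
  moreover have "pverts G0 = T" by (simp add: G0_def)
  ultimately show ?thesis by blast
qed

text \<open>An eigenvector for the largest eigenvalue, carried over from indices to vertices by the
  numbering, has that eigenvalue as its Rayleigh quotient. This is the only bridge from the matrix
  to the form.\<close>

lemma largest_eigenvalue_qform:
  fixes G :: "'a pair_pre_digraph"
  assumes G: "pair_graph G" and ne: "pverts G \<noteq> {}"
  shows "\<exists>y. 0 < (\<Sum>u\<in>pverts G. (y u)\<^sup>2) \<and>
    simple_graph_relation.qform (\<lambda>u v. (u, v) \<in> parcs G) (pverts G) y =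
      largest_eigenvalue G * (\<Sum>u\<in>pverts G. (y u)\<^sup>2)"
proof -
  interpret G: pair_graph G by (rule G)
  interpret E: simple_graph_relation "\<lambda>u v. (u, v) \<in> parcs G"
    by (rule simple_graph_relation_parcs [OF G])
  define V where "V = pverts G"
  define n where "n = card V"
  define \<phi> where "\<phi> = vertex_numbering G"
  define A where "A = adjacency_matrix G"
  have fin: "finite V" by (simp add: V_def)
  have "\<exists>f. bij_betw f {0..<n} V" unfolding n_def using fin by (rule ex_bij_betw_nat_finite)
  then have \<phi>: "bij_betw \<phi> {0..<n} V"
    unfolding \<phi>_def vertex_numbering_def n_def V_def by (rule someI_ex)
  have dim: "A \<in> carrier_mat n n" by (simp add: A_def adjacency_matrix_def n_def V_def)
  have re: "(\<Sum>u\<in>V. h u) = (\<Sum>i<n. h (\<phi> i))" for h :: "'a \<Rightarrow> real"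
    using sum.reindex_bij_betw [OF \<phi>, of h] by (simp add: lessThan_atLeast0)
  have mult: "(A *\<^sub>v z) $ i = (\<Sum>v\<in>E.nb V (\<phi> i). y v)"
    if i: "i < n" and z: "z \<in> carrier_vec n" and zy: "\<And>i. i < n \<Longrightarrow> z $ i = y (\<phi> i)" for z y i
  proof -
    have "(A *\<^sub>v z) $ i = (\<Sum>j<n. A $$ (i, j) * z $ j)"
      using i z dim by (simp add: scalar_prod_def lessThan_atLeast0)
    also have "\<dots> = (\<Sum>j<n. if (\<phi> i, \<phi> j) \<in> parcs G then y (\<phi> j) else 0)"
      using i zy by (intro sum.cong) (auto simp: A_def adjacency_matrix_def n_def V_def \<phi>_def)
    also have "\<dots> = (\<Sum>v\<in>V. if (\<phi> i, v) \<in> parcs G then y v else 0)" by (simp add: re)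
    also have "\<dots> = (\<Sum>v\<in>E.nb V (\<phi> i). y v)" using fin by (simp add: E.nb_def sum.inter_filter)
    finally show ?thesis .
  qed
  \<comment> \<open>\<open>Max\<close> yields an eigenvalue only for a nonempty spectrum, and a real
    matrix may have no real eigenvalue; the Perron vector supplies one.\<close>
  have "spectrum A \<noteq> {}"
  proof -
    obtain l x where per: "E.is_perron V l x" using E.perron_exists [OF fin] ne by (auto simp: V_def)
    have x1: "(\<Sum>u\<in>V. (x u)\<^sup>2) = 1" and eig: "\<And>u. u \<in> V \<Longrightarrow> (\<Sum>v\<in>E.nb V u. x v) = l * x u"
      using per by (auto simp: E.is_perron_def)
    define z where "z = vec n (\<lambda>i. x (\<phi> i))"
    have z: "z \<in> carrier_vec n" by (simp add: z_def)
    have "z \<noteq> 0\<^sub>v n"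
    proof
      assume "z = 0\<^sub>v n"
      then have "z $ i = 0" if "i < n" for i using that by simp
      then have "x (\<phi> i) = 0" if "i < n" for i using that by (simp add: z_def)
      then have "(\<Sum>u\<in>V. (x u)\<^sup>2) = 0" unfolding re by simp
      then show False using x1 by simp
    qed
    moreover have "A *\<^sub>v z = l \<cdot>\<^sub>v z"
    proof (rule eq_vecI)
      fix i assume "i < dim_vec (l \<cdot>\<^sub>v z)"
      then have i: "i < n" by (simp add: z_def)
      then have "\<phi> i \<in> V" using \<phi> by (auto simp: bij_betw_def)
      then show "(A *\<^sub>v z) $ i = (l \<cdot>\<^sub>v z) $ i"
        using mult [OF i z, of x] eig i by (simp add: z_def)
    qed (use dim z in auto)
    ultimately have "eigenvector A z l" using z dim by (auto simp: eigenvector_def)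
    then show ?thesis by (auto simp: spectrum_def eigenvalue_def)
  qed
  then have "Max (spectrum A) \<in> spectrum A" using card_finite_spectrum(1) [OF dim] by (intro Max_in)
  then obtain z where ev: "eigenvector A z (largest_eigenvalue G)"
    by (auto simp: spectrum_def eigenvalue_def largest_eigenvalue_def A_def)
  then have z: "z \<in> carrier_vec n" "z \<noteq> 0\<^sub>v n" and Az: "A *\<^sub>v z = largest_eigenvalue G \<cdot>\<^sub>v z"
    using dim by (auto simp: eigenvector_def)
  define y where "y = (\<lambda>v. z $ (the_inv_into {0..<n} \<phi> v))"
  have zy: "z $ i = y (\<phi> i)" if "i < n" for i
    using that \<phi> by (simp add: y_def the_inv_into_f_f bij_betw_def)
  have row: "(\<Sum>v\<in>E.nb V (\<phi> i). y v) = largest_eigenvalue G * y (\<phi> i)" if i: "i < n" for i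
    using mult [OF i z(1) zy] i z(1) by (simp add: Az zy)
  have "E.qform V y = largest_eigenvalue G * (\<Sum>u\<in>V. (y u)\<^sup>2)"
    unfolding E.qform_def re by (simp add: row power2_eq_square sum_distrib_left ac_simps)
  moreover have "0 < (\<Sum>u\<in>V. (y u)\<^sup>2)"
  proof -
    have "\<exists>i<n. z $ i \<noteq> 0" using z by (metis carrier_vecD eq_vecI index_zero_vec)
    then obtain i where i: "i < n" "y (\<phi> i) \<noteq> 0" using zy by auto
    then have "\<phi> i \<in> V" using \<phi> by (auto simp: bij_betw_def)
    then show ?thesis using i(2) fin by (intro sum_pos2 [of V "\<phi> i"]) auto
  qed
  ultimately show ?thesis unfolding V_def by blast
qed

section \<open>Choice of the constants and the split by (r+1)-cliques\<close>

theorem theorem6: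
  fixes r n :: nat and b c :: real and G :: "'a pair_pre_digraph"
  assumes "r \<ge> 2"
    and "c = real r powr (- real ((2 * r + 9) * (r + 1))) / 2"
    and "0 < b" and "b < 2 powr (-10) * real r powr (-6)"
    and "real n \<ge> exp (2 / c)"
    and "pair_graph G" and "card (pverts G) = n"
    and "largest_eigenvalue G > (1 - 1 / real r - b) * real n"
  shows "(\<exists>H. subgraph (with_proj H) (with_proj G) \<and>
            digraph_iso (with_proj H) (with_proj (K_plus r (\<lambda>_. nat \<lfloor>c * ln (real n)\<rfloor>)))) \<or>
         (\<exists>G\<^sub>0. induced_subgraph (with_proj G\<^sub>0) (with_proj G) \<and> partite r G\<^sub>0 \<and>
            real (card (pverts G\<^sub>0)) \<ge> (1 - 4 * b powr (1 / 3)) * real n \<and>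
            real (min_degree G\<^sub>0) > (1 - 1 / real r - 7 * b powr (1 / 3)) * real n)"
proof -
  interpret G: pair_graph G by (rule assms(6))
  interpret E: simple_graph_relation "\<lambda>u v. (u, v) \<in> parcs G"
    by (rule simple_graph_relation_parcs [OF assms(6)])
  define V where "V = pverts G"
  define \<rho> where "\<rho> = real r"
  define N where "N = (2 * r + 9) * (r + 1)"
  define \<beta> where "\<beta> = b powr (1 / 3)"
  define \<alpha> where "\<alpha> = 1 / (8 * \<rho> ^ 4)"
  define \<eta> where "\<eta> = 1 / (7 * \<rho> ^ 4)"
  define \<gamma> where "\<gamma> = 1 - 1 / \<rho> - b"
  define s where "s = nat \<lfloor>c * ln (real n)\<rfloor>"
  have finV: "finite V" and nV: "card V = n" using assms(7) by (simp_all add: V_def)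
  have \<rho>: "2 \<le> \<rho>" using assms(1) by (simp add: \<rho>_def)
  have \<rho>4: "16 \<le> \<rho> ^ 4" using power_mono [of 2 \<rho> 4] \<rho> by simp
  have b6: "b * \<rho> ^ 6 < 1 / 1024"
  proof -
    have "(2::real) powr (-10) = 1 / 1024" by (simp add: powr_minus_divide)
    moreover have "\<rho> powr (-6) = 1 / \<rho> ^ 6" using \<rho> by (simp add: powr_minus_divide)
    ultimately have "b < 1 / 1024 * (1 / \<rho> ^ 6)" using assms(4) by (simp only: \<rho>_def)
    then show ?thesis using \<rho> by (simp add: field_simps)
  qed
  have \<beta>0: "0 < \<beta>" using assms(3) by (simp add: \<beta>_def)
  have \<beta>3: "b = \<beta> ^ 3"
  proof -
    have "\<beta> ^ 3 = \<beta> powr 3" using \<beta>0 by simp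
    also have "\<dots> = b" using assms(3) by (simp add: \<beta>_def powr_powr)
    finally show ?thesis by simp
  qed
  \<comment> \<open>Cubing reduces the claim to 1000 b \<rho>^6 < 1, and the hypothesis on b gives b
    \<rho>^6 < 1/1024.\<close>
  have \<beta>\<rho>: "10 * \<beta> * \<rho>\<^sup>2 < 1"
  proof (rule ccontr)
    assume "\<not> ?thesis"
    then have "1 ^ 3 \<le> (10 * \<beta> * \<rho>\<^sup>2) ^ 3" by (intro power_mono) auto
    also have "\<dots> = 1000 * (b * \<rho> ^ 6)" by (simp add: \<beta>3 power_mult_distrib flip: power_mult)
    finally show False using b6 by simp
  qed
  have \<beta>40: "\<beta> < 1 / 40"
  proof -
    have "10 * \<beta> * 2\<^sup>2 \<le> 10 * \<beta> * \<rho>\<^sup>2" using \<rho> \<beta>0 by (intro mult_left_mono power_mono) auto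
    then show ?thesis using \<beta>\<rho> by simp
  qed
  have b4: "b * \<rho> ^ 4 \<le> 1 / 4096"
  proof -
    have "b * \<rho> ^ 4 * 2\<^sup>2 \<le> b * \<rho> ^ 4 * \<rho>\<^sup>2" using \<rho> assms(3) by (intro mult_left_mono power_mono) auto
    also have "\<dots> = b * \<rho> ^ 6" by (simp add: mult.assoc flip: power_add)
    finally show ?thesis using b6 by simp
  qed
  have b_small: "b \<le> 1 / 65536"
  proof -
    have "b * 16 \<le> b * \<rho> ^ 4" using \<rho>4 assms(3) by (intro mult_left_mono) auto
    then show ?thesis using b4 by simp
  qed
  have \<rho>inv: "1 / \<rho> \<le> 1 / 2" "0 < 1 / \<rho>" using \<rho> by simp_all
  have \<gamma>4: "1 / 4 \<le> \<gamma>" unfolding \<gamma>_def using \<rho>inv b_small by linarith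
  have \<alpha>: "0 < \<alpha>" "\<alpha> \<le> 1 / 4" using \<rho> \<rho>4 by (simp_all add: \<alpha>_def field_simps)
  have c: "c = 1 / (2 * \<rho> ^ N)"
  proof -
    have "c = \<rho> powr (- real N) / 2" using assms(2) by (simp only: \<rho>_def N_def)
    also have "\<rho> powr (- real N) = 1 / \<rho> ^ N" using \<rho> by (simp add: powr_minus_divide powr_realpow)
    finally show ?thesis by simp
  qed
  have c0: "0 < c" using \<rho> by (simp add: c)
  have N8: "\<rho> ^ 4 * 16 \<le> \<rho> ^ N"
  proof -
    have "\<rho> ^ 4 * 16 \<le> \<rho> ^ 4 * \<rho> ^ 4" using \<rho>4 by (intro mult_left_mono) auto
    also have "\<dots> = \<rho> ^ 8" by (simp flip: power_add)
    also have "\<dots> \<le> \<rho> ^ N" using \<rho> by (intro power_increasing) (auto simp: N_def)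
    finally show ?thesis .
  qed
  have n0: "0 < real n" using assms(5) by (rule less_le_trans [OF exp_gt_zero])
  have lnn: "4 * \<rho> ^ N \<le> ln n"
  proof -
    have "ln (exp (2 / c)) \<le> ln n" using assms(5) n0 by (subst ln_le_cancel_iff) auto
    then show ?thesis by (simp add: c)
  qed
  have cln: "2 \<le> c * ln n"
  proof -
    have "c * (4 * \<rho> ^ N) \<le> c * ln n" using lnn c0 by (intro mult_left_mono) auto
    then show ?thesis using \<rho> by (simp add: c)
  qed
  have s2: "2 \<le> s" unfolding s_def using cln by linarith
  have s_le: "real s \<le> c * ln n" unfolding s_def using cln by linarith
  obtain y where y: "0 < (\<Sum>u\<in>V. (y u)\<^sup>2)" "E.qform V y = largest_eigenvalue G * (\<Sum>u\<in>V. (y u)\<^sup>2)"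
  proof -
    have "V \<noteq> {}" using nV n0 by auto
    then show ?thesis using largest_eigenvalue_qform [OF assms(6)] that unfolding V_def by blast
  qed
  \<comment> \<open>With 3/\<alpha> = 24 \<rho>^4 and 2/\<alpha> = 16 \<rho>^4 the claim follows
    from exp(40 \<rho>^4) \<le> n.\<close>
  have large: "2 * exp (3 / \<alpha>) \<le> \<alpha> * card V"
  proof -
    have "16 * \<rho> ^ 4 \<le> exp (16 * \<rho> ^ 4)" using exp_ge_add_one_self [of "16 * \<rho> ^ 4"] by linarith
    then have "exp (24 * \<rho> ^ 4) * (16 * \<rho> ^ 4) \<le> exp (24 * \<rho> ^ 4) * exp (16 * \<rho> ^ 4)" by (intro mult_left_mono) auto
    also have "\<dots> = exp (40 * \<rho> ^ 4)" by (simp flip: exp_add)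
    also have "\<dots> \<le> exp (ln n)" unfolding exp_le_cancel_iff using lnn N8 \<rho>4 by linarith
    also have "\<dots> = n" using n0 by simp
    finally have "exp (24 * \<rho> ^ 4) * (16 * \<rho> ^ 4) \<le> n" .
    moreover have "3 / \<alpha> = 24 * \<rho> ^ 4" by (simp add: \<alpha>_def)
    ultimately show ?thesis using \<rho> unfolding nV by (simp add: \<alpha>_def field_simps)
  qed
  have "\<gamma> * card V * (\<Sum>u\<in>V. (y u)\<^sup>2) \<le> E.qform V y"
    unfolding y(2) nV using assms(8) y(1) by (intro mult_right_mono) (auto simp: \<gamma>_def \<rho>_def)
  then obtain S l x where S: "S \<subseteq> V" "S \<noteq> {}" and per: "E.is_perron S l x"
    and l: "\<gamma> * (1 + \<alpha> * ln (n / card S)) * card S \<le> l"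
    and deg: "\<And>u. u \<in> S \<Longrightarrow> l - \<alpha> * card S < card (E.nb S u)" and lnS: "ln (n / card S) \<le> 3 / \<alpha>"
    using E.spectral_core_exists [OF finV \<alpha> \<gamma>4 large y(1)] unfolding nV by blast
  define m where "m = real (card S)"
  have finS: "finite S" using S(1) finV by (rule finite_subset)
  have m0: "0 < m" using S(2) finS by (simp add: m_def card_gt_0_iff)
  have mn: "m \<le> n" using card_mono [OF finV S(1)] by (simp add: m_def nV)
  have L0: "0 \<le> ln (n / m)" using mn m0 by simp
  have lm: "\<gamma> * m \<le> l"
  proof -
    have "\<gamma> * 1 * m \<le> \<gamma> * (1 + \<alpha> * ln (n / m)) * m"
      using \<gamma>4 \<alpha> L0 m0 by (intro mult_right_mono mult_left_mono) auto
    then show ?thesis using l by (simp add: m_def)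
  qed
  \<comment> \<open>The gap between 1/(8 \<rho>^4) and 1/(7 \<rho>^4) is 1/(56 \<rho>^4), of which b
    takes only a small part.\<close>
  have \<alpha>b: "\<alpha> + b \<le> \<eta>"
  proof -
    have "b \<le> 1 / 4096 / \<rho> ^ 4" using b4 \<rho> by (simp add: field_simps)
    also have "\<dots> \<le> (1 / 56) / \<rho> ^ 4" using \<rho> by (intro divide_right_mono) auto
    also have "\<dots> = \<eta> - \<alpha>" using \<rho> by (simp add: \<eta>_def \<alpha>_def field_simps)
    finally show ?thesis by simp
  qed
  define \<kappa> where "\<kappa> = (1 / r + \<eta>) * card S"
  have \<kappa>m: "\<kappa> = m / \<rho> + \<eta> * m" by (simp add: \<kappa>_def m_def \<rho>_def algebra_simps)
  have non: "card (E.nnb S u) \<le> \<kappa>" if u: "u \<in> S" for u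
  proof -
    have "real (card (E.nb S u)) + card (E.nnb S u) = m"
      using E.card_nb_nnb [OF finS, of u] by (simp add: m_def flip: of_nat_add)
    then have "card (E.nnb S u) \<le> m - (\<gamma> * m - \<alpha> * m)" using deg [OF u] lm by (simp add: m_def)
    also have "\<dots> = m / \<rho> + (\<alpha> + b) * m" by (simp add: \<gamma>_def algebra_simps)
    also have "\<dots> \<le> \<kappa>" unfolding \<kappa>m using \<alpha>b m0 by (intro add_left_mono mult_right_mono) auto
    finally show ?thesis .
  qed
  show ?thesis
  proof (cases "E.cliques (r + 1) S = {}")
    case False
    define q where "q = 2 * r ^ (r + 2)"
    define p where "p = s * (2 ^ r * q) ^ (r - 1)"
    have q0: "0 < q" using assms(1) by (simp add: q_def)
    \<comment> \<open>The aim is a power of r: 2^r q is at most r^(2r+3), and twice its (r - 1)st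
      power stays below r^N = 1/(2c). Hence the exponent p is at most a quarter of ln n.\<close>
    have "2 ^ r * q = 2 ^ (r + 1) * r ^ (r + 2)" by (simp add: q_def)
    also have "\<dots> \<le> r ^ (r + 1) * r ^ (r + 2)" using assms(1) by (intro mult_right_mono power_mono) auto
    also have "\<dots> = r ^ (2 * r + 3)"
    proof -
      have "r + 1 + (r + 2) = 2 * r + 3" by simp
      then show ?thesis by (simp only: power_add [symmetric])
    qed
    finally have "(2 ^ r * q) ^ (r - 1) \<le> (r ^ (2 * r + 3)) ^ (r - 1)" by (intro power_mono) auto
    also have "\<dots> = r ^ ((2 * r + 3) * (r - 1))" by (simp only: power_mult)
    finally have e1: "(2 ^ r * q) ^ (r - 1) \<le> r ^ ((2 * r + 3) * (r - 1))" .
    have "2 * r ^ ((2 * r + 3) * (r - 1)) \<le> r * r ^ ((2 * r + 3) * (r - 1))"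
      using assms(1) by (intro mult_right_mono) auto
    also have "\<dots> = r ^ ((2 * r + 3) * (r - 1) + 1)" by simp
    also have "\<dots> \<le> r ^ N"
    proof (rule power_increasing)
      have "(2 * r + 3) * (r - 1) \<le> (2 * r + 9) * r" by (intro mult_mono) auto
      then show "(2 * r + 3) * (r - 1) + 1 \<le> N" by (simp add: N_def)
    qed (use assms(1) in auto)
    finally have "2 * (2 ^ r * q) ^ (r - 1) \<le> r ^ N" using e1 by linarith
    then have e2: "2 * real ((2 ^ r * q) ^ (r - 1)) \<le> \<rho> ^ N"
      unfolding \<rho>_def by (metis of_nat_le_iff of_nat_mult of_nat_numeral of_nat_power)
    have "real p = s * real ((2 ^ r * q) ^ (r - 1))" by (simp add: p_def)
    also have "\<dots> \<le> c * ln n * (\<rho> ^ N / 2)" using s_le e2 by (intro mult_mono) auto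
    also have "\<dots> = ln n / 4" using \<rho> by (simp add: c)
    finally have p4: "real p \<le> ln n / 4" .
    \<comment> \<open>Passing from V to S costs at most 3/\<alpha> in the logarithm, which is no
      more than half of ln n.\<close>
    have "ln n - ln m \<le> 24 * \<rho> ^ 4" using lnS n0 m0 by (simp add: ln_div m_def \<alpha>_def)
    moreover have "48 * \<rho> ^ 4 \<le> ln n" using lnn N8 \<rho>4 by linarith
    ultimately have "ln n / 2 \<le> ln m" by linarith
    then have p2: "real p * 2 \<le> ln m" using p4 by linarith
    have "(4::real) \<le> exp 2"
    proof -
      have "(2::real) * 2 \<le> exp 1 * exp 1" using exp_ge_add_one_self [of 1] by (intro mult_mono) auto
      then show ?thesis by (simp flip: exp_add)
    qed
    then have "(4::real) ^ p \<le> exp 2 ^ p" by (intro power_mono) auto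
    also have "\<dots> = exp (real p * 2)" by (simp only: exp_of_nat_mult)
    also have "\<dots> \<le> exp (ln m)" using p2 by (simp only: exp_le_cancel_iff)
    also have "\<dots> = m" using m0 by simp
    finally have "real (4 ^ p) \<le> real (card S)" by (simp add: m_def)
    then have four_p: "4 ^ p \<le> card S" by (simp only: of_nat_le_iff)
    have "q * s \<le> p"
    proof -
      have "1 * q \<le> 2 ^ r * q" by (intro mult_right_mono) auto
      also have "\<dots> \<le> (2 ^ r * q) ^ (r - 1)" using assms(1) q0 by (intro self_le_power) auto
      finally show ?thesis unfolding p_def by (simp add: mult.commute)
    qed
    also have "p \<le> 4 ^ p" by (rule less_imp_le, rule power_gt_expt) simp
    also note four_p
    finally have qs: "q * s \<le> card S" .
    have "0 < card S" using m0 by (simp add: m_def)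
    then have "\<exists>A u v. (\<forall>i<r. A i \<subseteq> S \<and> s \<le> card (A i)) \<and>
        (\<forall>i<r. \<forall>j<r. i \<noteq> j \<longrightarrow> (\<forall>x\<in>A i. \<forall>y\<in>A j. (x, y) \<in> parcs G)) \<and>
        u \<in> A 0 \<and> v \<in> A 0 \<and> (u, v) \<in> parcs G"
      by (rule E.clique_imp_blowup [OF finS _ assms(1) \<eta>_def [unfolded \<rho>_def] \<kappa>_def non False
            q_def qs four_p [unfolded p_def]])
    then obtain A u v where A: "\<forall>i<r. A i \<subseteq> S \<and> s \<le> card (A i)"
      and adj: "\<forall>i<r. \<forall>j<r. i \<noteq> j \<longrightarrow> (\<forall>x\<in>A i. \<forall>y\<in>A j. (x, y) \<in> parcs G)"
      and uv: "u \<in> A 0" "v \<in> A 0" "(u, v) \<in> parcs G"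
      by (elim exE conjE) (rule that)
    have "1 \<le> r" using assms(1) by simp
    moreover have "\<forall>i<r. A i \<subseteq> pverts G \<and> s \<le> card (A i)" using A S(1) unfolding V_def by blast
    ultimately show ?thesis
      using K_plus_embedding [OF assms(6) _ s2 _ adj uv] unfolding s_def by (intro disjI1)
  next
    case True
    define \<omega> where "\<omega> = r * \<kappa> - card S"
    have \<kappa>ge: "m / \<rho> < \<kappa>" "0 < \<kappa>"
    proof -
      have "0 < \<eta> * m" "0 < m / \<rho>" using \<rho> m0 by (simp_all add: \<eta>_def)
      then show "m / \<rho> < \<kappa>" "0 < \<kappa>" unfolding \<kappa>m by linarith+
    qed
    \<comment> \<open>As \<omega> is the fraction 1/(7 \<rho>^2) of m/\<rho>, multipliers up to 7
      \<rho>^2 are admissible; both multipliers in the colouring lemma lie below that.\<close>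
    have \<omega>: "\<omega> = m / \<rho> * (1 / (7 * \<rho>\<^sup>2))"
    proof -
      have "\<omega> = \<rho> * \<eta> * m" using \<rho> by (simp add: \<omega>_def \<kappa>m \<rho>_def [symmetric] m_def [symmetric] distrib_left)
      also have "\<dots> = m / \<rho> * (1 / (7 * \<rho>\<^sup>2))" using \<rho> by (simp add: \<eta>_def field_simps eval_nat_numeral)
      finally show ?thesis .
    qed
    have small: "real k * \<omega> < \<kappa>" if k: "real k \<le> 7 * \<rho>\<^sup>2" for k
    proof -
      have "real k * \<omega> = m / \<rho> * (k / (7 * \<rho>\<^sup>2))" by (simp add: \<omega>)
      also have "\<dots> \<le> m / \<rho> * 1" using k \<rho> m0 by (intro mult_left_mono) auto
      finally show ?thesis using \<kappa>ge by simp
    qed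
    have \<rho>2: "2 * \<rho> \<le> \<rho>\<^sup>2" using \<rho> by (simp add: power2_eq_square)
    have s1: "real (r\<^sup>2 + r + 1) * \<omega> < \<kappa>" and s2: "real (2 * r + 3) * \<omega> < \<kappa>"
      using \<rho>2 \<rho> by (intro small, simp add: \<rho>_def)+
    obtain f where f: "\<And>w. w \<in> S \<Longrightarrow> f w < r"
      and col: "\<And>w w'. w \<in> S \<Longrightarrow> w' \<in> S \<Longrightarrow> f w = f w' \<Longrightarrow> (w, w') \<notin> parcs G"
      using E.clique_free_imp_colouring [OF finS S(2) \<kappa>ge(2) non assms(1) True \<omega>_def s1 s2] by blast
    have x: "\<And>u. 0 \<le> x u" "(\<Sum>u\<in>S. (x u)\<^sup>2) = 1" "E.qform S x = l"
      using per by (auto simp: E.is_perron_def)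
    have "l \<le> (1 - 1 / r) * card S \<and> (\<exists>T\<subseteq>S. (1 - \<beta> / 10) * card S \<le> card T \<and>
           (\<forall>u\<in>T. (1 - 1 / r - 3 * \<beta>) * card S \<le> card (E.nb T u)))"
      by (rule E.partite_large_min_degree [OF finS assms(1) f col x(1,2) \<beta>0 _ \<beta>3 x(3)])
        (use \<beta>\<rho> lm in \<open>auto simp: \<rho>_def \<gamma>_def m_def\<close>)
    then obtain T where l_le: "l \<le> (1 - 1 / \<rho>) * m" and T: "T \<subseteq> S" "(1 - \<beta> / 10) * m \<le> card T"
      and degT: "\<And>u. u \<in> T \<Longrightarrow> (1 - 1 / \<rho> - 3 * \<beta>) * m \<le> card (E.nb T u)"
      unfolding \<rho>_def m_def by blast
    \<comment> \<open>Second use of the potential: the upper bound for l leaves only b for the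
      growth \<gamma> \<alpha> L. So L is at most 32 b \<rho>^4 = 32 \<beta> (\<beta> \<rho>^2)^2,
      and \<beta> \<rho>^2 < 1/10 brings this below \<beta>.\<close>
    have mn\<beta>: "(1 - \<beta>) * n \<le> m"
    proof -
      define L where "L = ln (n / m)"
      have "\<gamma> * (1 + \<alpha> * L) * m \<le> (1 - 1 / \<rho>) * m" using l l_le by (simp add: L_def m_def)
      then have "\<gamma> * (1 + \<alpha> * L) \<le> 1 - 1 / \<rho>" using m0 by simp
      then have "\<gamma> * (\<alpha> * L) \<le> b" by (simp add: \<gamma>_def algebra_simps)
      moreover have "1 / 4 * (\<alpha> * L) \<le> \<gamma> * (\<alpha> * L)"
        using \<gamma>4 \<alpha> L0 by (intro mult_right_mono) (auto simp: L_def)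
      ultimately have "L \<le> 32 * (b * \<rho> ^ 4)" using \<rho> by (simp add: \<alpha>_def field_simps)
      also have "b * \<rho> ^ 4 = \<beta> * (\<beta> * \<rho>\<^sup>2)\<^sup>2" by (simp add: \<beta>3 eval_nat_numeral)
      also have "(\<beta> * \<rho>\<^sup>2)\<^sup>2 \<le> (1 / 10)\<^sup>2" using \<beta>\<rho> \<beta>0 by (intro power_mono) auto
      finally have "L \<le> \<beta>" using \<beta>0 by (simp add: power2_eq_square)
      have "ln (m / n) \<le> m / n - 1" using m0 n0 by (intro ln_le_minus_one) auto
      moreover have "ln (m / n) = - L" using m0 n0 by (simp add: L_def ln_div)
      ultimately have "1 - \<beta> \<le> m / n" using \<open>L \<le> \<beta>\<close> by linarith
      then show ?thesis using n0 by (simp add: le_divide_eq)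
    qed
    have \<beta>n: "0 < \<beta> * n" using \<beta>0 n0 by simp
    have "(1 - 4 * \<beta>) * n \<le> card T"
    proof -
      have "(1 - \<beta> / 10) * ((1 - \<beta>) * n) \<le> (1 - \<beta> / 10) * m"
        using mn\<beta> \<beta>40 by (intro mult_left_mono) auto
      moreover have "(1 - \<beta> / 10) * ((1 - \<beta>) * n) = n - 11 / 10 * (\<beta> * n) + \<beta> / 10 * (\<beta> * n)"
        by (simp add: field_simps)
      moreover have "0 \<le> \<beta> / 10 * (\<beta> * n)" using \<beta>0 n0 by simp
      ultimately show ?thesis using T(2) \<beta>n by (simp add: left_diff_distrib)
    qed
    moreover have T0: "T \<noteq> {}"
    proof -
      have "0 < (1 - \<beta> / 10) * m" using \<beta>40 m0 by simp
      then show ?thesis using T(2) by auto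
    qed
    moreover have "(1 - 1 / \<rho> - 7 * \<beta>) * n < card {v \<in> T. (u, v) \<in> parcs G}" if u: "u \<in> T" for u
    proof -
      \<comment> \<open>Replacing m by (1 - \<beta>) n costs at most another \<beta> n because d
        \<le> 1; strictness comes from \<beta> n > 0.\<close>
      define d where "d = 1 - 1 / \<rho> - 3 * \<beta>"
      have d: "0 \<le> d" "d \<le> 1" unfolding d_def using \<rho>inv \<beta>40 \<beta>0 by linarith+
      have "(1 - 1 / \<rho> - 7 * \<beta>) * n = d * n - 4 * (\<beta> * n)" by (simp add: d_def algebra_simps)
      also have "\<dots> < d * n - d * (\<beta> * n)"
      proof -
        have "d * (\<beta> * n) \<le> 1 * (\<beta> * n)" using d \<beta>n by (intro mult_right_mono) auto
        then show ?thesis using \<beta>n by linarith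
      qed
      also have "\<dots> = d * ((1 - \<beta>) * n)" by (simp add: algebra_simps)
      also have "\<dots> \<le> d * m" using mn\<beta> d by (intro mult_left_mono) auto
      also have "\<dots> \<le> card (E.nb T u)" using degT [OF u] by (simp add: d_def)
      finally show ?thesis by (simp add: E.nb_def)
    qed
    moreover have "T \<subseteq> pverts G" using T(1) S(1) by (simp add: V_def)
    ultimately have "\<exists>G0. induced_subgraph (with_proj G0) (with_proj G) \<and> partite r G0 \<and> pverts G0 = T \<and>
        (1 - 1 / \<rho> - 7 * \<beta>) * n < min_degree G0"
      using f col T(1) by (intro partite_induced_subgraph [OF assms(6), of T f]) (auto simp: subset_iff)
    with \<open>(1 - 4 * \<beta>) * n \<le> card T\<close> show ?thesis unfolding \<rho>_def \<beta>_def by blast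
  qed
qed

end
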